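(* Let $\phi:\mathbb{R}\to\mathbb{C}\simeq\mathbb{R}^2$ be Riemann's non-differentiable function $$\phi(x)=\sum_{k\in\mathbb{Z}}\frac{e^{-4\pi^2 i k^2 x}-1}{-4\pi^2k^2},$$ where the term $k=0$ is understood as $ix$. Let $t\in\mathbb{R}$ and $\mathbb{V}\in\mathbb{S}^1$. Then $\mathbb{V}$ is not a (geometric) tangent of the set $\phi(\mathbb{R})$ at the point $\phi(t)$.
   Context: $\mathbb{C}$ is identified with $\mathbb{R}^2$ and $\mathbb{S}^{n-1}$ is the unit sphere of $\mathbb{R}^n$. $B(x,r)$ is the open ball of center $x$ and radius $r$. The $1$-Hausdorff content of $F\subset\mathbb{R}^n$ is $$\mathcal{H}^1_\infty(F)=\inf\Big\{\sum_{i\in I}\operatorname{diam}U_i \;:\; F\subset\bigcup_{i\in I}U_i,\ I\text{ countable}\Big\}.$$ For $x\in\mathbb{R}^n$, $\mathbb{V}\in\mathbb{S}^{n-1}$, $\varphi>0$, the closed double cone $S_D(x,\mathbb{V},\varphi)$ is the closure of the set of those $y\in\mathbb{R}^n$ such that $y-x$ forms an angle at most $\varphi/2$ with $\mathbb{V}$ or with $-\mathbb{V}$. Definition (geometric tangent). Let $F\subset\mathbb{R}^n$ be the image of some continuous curve. A vector $\mathbb{V}\in\mathbb{S}^{n-1}$ is a tangent of $F$ at $x\in F$ if $$\limsup_{r\to0}\frac{\mathcal{H}^1_\infty(F\cap B(x,r))}{2r}>0$$ and $$\lim_{r\to0}\frac{\mathcal{H}^1_\infty\big((F\cap B(x,r))\setminus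 S_D(x,\mathbb{V},\varphi)\big)}{2r}=0\qquad\text{for all }\varphi>0.$$ *)

theory Defs
  imports "HOL-Analysis.Analysis"
begin

(* The library's real-valued diameter is meaningless on unbounded sets,
   so diameters are taken in [0, infinity]. *)
definition ediam :: "'a::metric_space set \<Rightarrow> ennreal" where
  "ediam U = (SUP x\<in>U. SUP y\<in>U. ennreal (dist x y))"

(* Countable covers are indexed by nat: a finite cover is padded with empty sets,
   which have diameter 0. *)
definition hausdorff_content1 :: "'a::metric_space set \<Rightarrow> ennreal" where
  "hausdorff_content1 F =
     (INF U\<in>{U :: nat \<Rightarrow> 'a set. F \<subseteq> (\<Union>i. U i)}. \<Sum>i. ediam (U i))"

definition vec_angle :: "'a::real_inner \<Rightarrow> 'a \<Rightarrow> real" where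
  "vec_angle u v = arccos ((u \<bullet> v) / (norm u * norm v))"

(* At the apex y = x the angle is undefined (and vec_angle has a dummy value). This is
   harmless: for a unit vector V and \<phi> > 0 the apex lies in the closure anyway. *)
definition double_cone :: "'a::euclidean_space \<Rightarrow> 'a \<Rightarrow> real \<Rightarrow> 'a set" where
  "double_cone x V \<phi> =
     closure {y. vec_angle (y - x) V \<le> \<phi> / 2 \<or> vec_angle (y - x) (- V) \<le> \<phi> / 2}"

(* Intended for F the image of a continuous curve, x in F and V in the unit sphere. *)
definition geometric_tangent :: "'a::euclidean_space set \<Rightarrow> 'a \<Rightarrow> 'a \<Rightarrow> bool" where
  "geometric_tangent F x V \<longleftrightarrow>
     Limsup (at_right 0) (\<lambda>r. hausdorff_content1 (F \<inter> ball x r) / ennreal (2 * r)) > 0 \<and>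
     (\<forall>\<phi>>0. ((\<lambda>r. hausdorff_content1 ((F \<inter> ball x r) - double_cone x V \<phi>) / ennreal (2 * r))
               \<longlongrightarrow> 0) (at_right 0))"

definition riemann_phi :: "real \<Rightarrow> complex" where
  "riemann_phi x =
     (\<Sum>\<^sub>\<infinity>k\<in>(UNIV :: int set).
        if k = 0 then \<i> * of_real x
        else (exp (- 4 * of_real pi ^ 2 * \<i> * of_int k ^ 2 * of_real x) - 1)
             / (- 4 * of_real pi ^ 2 * of_int k ^ 2))"

end

theory Submission
  imports Defs "HOL-Complex_Analysis.Complex_Analysis" "HOL-Probability.Characteristic_Functions"
begin

text \<open>The image \<open>F\<close> of the curve is connected, so a tangent at \<open>x\<close> forces \<open>F \<inter> ball x r\<close> into an
  \<open>\<epsilon> r\<close>-neighbourhood of a line for all small \<open>r\<close>. This is contradicted by corners. In the variable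
  \<open>X = -4 \<pi> t\<close> the increments of the curve are integrals of the theta function along the imaginary
  axis; the Poisson summation formula turns a \<open>q\<close>-periodic quadratic phase into its Gauss sums, and
  yields, at a fraction \<open>p/q\<close> with \<open>pq\<close> even, the increment \<open>2 G q\<^sup>-\<^sup>1 (- \<i> H)\<^sup>1\<^sup>/\<^sup>2\<close> up to \<open>O (q\<^sup>3\<^sup>/\<^sup>2 \<bar>H\<bar>\<^sup>3\<^sup>/\<^sup>2)\<close>,
  where \<open>\<bar>G\<bar> = q\<^sup>1\<^sup>/\<^sup>2\<close>. Hence the curve has a right angle of size comparable to \<open>q\<^sup>-\<^sup>3\<^sup>/\<^sup>2\<close> at every such
  \<open>p/q\<close>. An irrational \<open>X\<close> has infinitely many such \<open>p/q\<close> within \<open>6/q\<^sup>2\<close>, and these corners lie at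
  distance \<open>O (q\<^sup>-\<^sup>3\<^sup>/\<^sup>2)\<close> from the point of the curve at \<open>X\<close>. If \<open>X = h/k\<close> with \<open>hk\<close> odd, the Gauss sum at \<open>X\<close> vanishes,
  so the curve moves only by \<open>O (\<bar>H\<bar>\<^sup>3\<^sup>/\<^sup>2)\<close> near \<open>X\<close>, and the neighbours \<open>p/q\<close> with \<open>pk - hq = 1\<close>, at
  distance \<open>1/(kq)\<close> from \<open>X\<close>, again carry corners of size comparable to their distance.\<close>

section \<open>Content outside a cone\<close>

lemma hausdorff_content1_mono: "A \<subseteq> B \<Longrightarrow> hausdorff_content1 A \<le> hausdorff_content1 B"
  unfolding hausdorff_content1_def by (rule INF_superset_mono) auto

lemma dist_le_ediam: "x \<in> U \<Longrightarrow> y \<in> U \<Longrightarrow> ennreal (dist x y) \<le> ediam U"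
  unfolding ediam_def by (meson SUP_upper2 order_refl)

text \<open>The function \<open>dist _ P\<close> is 1-Lipschitz, so it maps each covering set into
  an interval centred at the image of any one of its points, of length twice the diameter.
  Subadditivity of Lebesgue measure then bounds \<open>\<eta>\<close>; the factor 2 is the price of
  this centring.\<close>

lemma hausdorff_content1_ge_radius:
  fixes A :: "'a::metric_space set"
  assumes "0 \<le> \<eta>" and img: "{0..<\<eta>} \<subseteq> (\<lambda>Q. dist Q P) ` A"
  shows "ennreal \<eta> \<le> 2 * hausdorff_content1 A"
proof -
  have "ennreal (\<eta> / 2) \<le> (\<Sum>i. ediam (U i))" if U: "A \<subseteq> (\<Union>i. U i)" for U :: "nat \<Rightarrow> 'a set"
  proof (cases "\<exists>i. ediam (U i) = top")
    case True
    then obtain i where "ediam (U i) = top" ..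
    moreover have "ediam (U i) \<le> (\<Sum>i. ediam (U i))"
      using sum_le_suminf[of "\<lambda>i. ediam (U i)" "{i}"] by simp
    ultimately show ?thesis by (simp add: top_unique)
  next
    case False
    define d where "d i = enn2real (ediam (U i))" for i
    have d: "ediam (U i) = ennreal (d i)" "d i \<ge> 0" for i
      using False by (auto simp: d_def less_top)
    \<comment> \<open>For empty \<open>U i\<close> the point \<open>u i\<close> is arbitrary, but
      then \<open>d i = 0\<close> and \<open>J i\<close> has measure zero.\<close>
    define u where "u i = (SOME x. x \<in> U i)" for i
    define J where "J i = {dist (u i) P - d i .. dist (u i) P + d i}" for i
    have "{0..<\<eta>} \<subseteq> (\<Union>i. J i)"
    proof
      fix s assume "s \<in> {0..<\<eta>}"
      then obtain Q where Q: "Q \<in> A" "s = dist Q P" using img by blast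
      then obtain i where i: "Q \<in> U i" using U by blast
      then have "u i \<in> U i" unfolding u_def by (rule someI)
      with i have "ennreal (dist Q (u i)) \<le> ennreal (d i)"
        using dist_le_ediam d by metis
      then have "dist Q (u i) \<le> d i" using d(2) by simp
      moreover have "\<bar>dist Q P - dist (u i) P\<bar> \<le> dist Q (u i)"
        by (smt (verit) dist_commute dist_triangle)
      ultimately have "s \<in> J i" unfolding J_def Q by auto
      then show "s \<in> (\<Union>i. J i)" by blast
    qed
    then have "emeasure lborel {0..<\<eta>} \<le> emeasure lborel (\<Union>i. J i)"
      by (intro emeasure_mono) (auto simp: J_def)
    also have "\<dots> \<le> (\<Sum>i. emeasure lborel (J i))"
      by (intro emeasure_subadditive_countably) (auto simp: J_def)
    also have "\<dots> = (\<Sum>i. 2 * ediam (U i))"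
    proof (intro suminf_cong)
      fix i
      have "emeasure lborel (J i) = ennreal (2 * d i)" using d(2)[of i] by (simp add: J_def)
      then show "emeasure lborel (J i) = 2 * ediam (U i)" using d by (simp add: ennreal_mult)
    qed
    also have "\<dots> = 2 * (\<Sum>i. ediam (U i))" by simp
    finally have "ennreal \<eta> \<le> 2 * (\<Sum>i. ediam (U i))" using assms(1) by simp
    moreover have "ennreal \<eta> = 2 * ennreal (\<eta>/2)" using assms(1) 
      by (metis ennreal_mult ennreal_numeral field_sum_of_halves mult_2 zero_le_divide_iff zero_le_numeral)
    ultimately show ?thesis
      by (metis ennreal_mult_le_mult_iff ennreal_numeral ennreal_neq_top numeral_neq_zero)
  qed
  then have "ennreal (\<eta> / 2) \<le> hausdorff_content1 A"
    unfolding hausdorff_content1_def by (auto intro!: INF_greatest)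
  then have "2 * ennreal (\<eta> / 2) \<le> 2 * hausdorff_content1 A" by (rule mult_left_mono) simp
  moreover have "ennreal \<eta> = 2 * ennreal (\<eta>/2)" using assms(1) 
      by (metis ennreal_mult ennreal_numeral field_sum_of_halves mult_2 zero_le_divide_iff zero_le_numeral)
  ultimately show ?thesis by simp
qed

text \<open>On the connected set F the distance to P takes the values 0 and \<open>dist x P\<close>,
  hence every value in between; values below \<open>\<eta>\<close> are attained inside the
  ball.\<close>

lemma hausdorff_content1_connected:
  assumes F: "connected F" "P \<in> F" "x \<in> F" and "0 \<le> \<eta>" "\<eta> \<le> dist P x"
  shows "ennreal \<eta> \<le> 2 * hausdorff_content1 (F \<inter> ball P \<eta>)"
proof (rule hausdorff_content1_ge_radius[where P = P])
  show "{0..<\<eta>} \<subseteq> (\<lambda>Q. dist Q P) ` (F \<inter> ball P \<eta>)"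
  proof
    fix s assume s: "s \<in> {0..<\<eta>}"
    have "connected ((\<lambda>Q. dist Q P) ` F)"
      by (intro connected_continuous_image continuous_intros F)
    moreover have "0 \<in> (\<lambda>Q. dist Q P) ` F" "dist x P \<in> (\<lambda>Q. dist Q P) ` F"
      using F by (auto simp: image_iff)
    ultimately have "s \<in> (\<lambda>Q. dist Q P) ` F"
      using s assms(5) connected_contains_Icc[of _ 0 "dist x P"]
      by (smt (verit) atLeastAtMost_iff atLeastLessThan_iff dist_commute subset_eq)
    then show "s \<in> (\<lambda>Q. dist Q P) ` (F \<inter> ball P \<eta>)" using s by (auto simp: dist_commute)
  qed
qed fact

text \<open>Multiplying by \<open>cnj V\<close> rotates V to 1, so the imaginary part is the
  component orthogonal to V, with modulus the distance times the sine of the angle to the axis. The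
  opening is twice \<open>arcsin \<epsilon>\<close> because the cone is defined by half its opening.
  At the apex both sides are 0, and the slab condition is closed, so it survives the
  closure.\<close>

lemma double_cone_subset_slab:
  fixes V x :: complex
  assumes V: "norm V = 1" and \<epsilon>: "0 < \<epsilon>" "\<epsilon> < 1"
  shows "double_cone x V (2 * arcsin \<epsilon>) \<subseteq> {y. \<bar>Im (cnj V * (y - x))\<bar> \<le> \<epsilon> * norm (y - x)}"
proof -
  have *: "\<bar>Im (cnj V * (y - x))\<bar> \<le> \<epsilon> * norm (y - x)"
    if W: "W = V \<or> W = - V" and le: "vec_angle (y - x) W \<le> arcsin \<epsilon>" for y W
  proof (cases "y = x")
    case False
    define z where "z = y - x"
    have nz: "norm z > 0" using False by (simp add: z_def)
    have nW: "norm W = 1" using V W by auto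
    define c where "c = (z \<bullet> W) / norm z"
    have "\<bar>z \<bullet> W\<bar> \<le> norm z * norm W" by (rule Cauchy_Schwarz_ineq2)
    then have c1: "\<bar>c\<bar> \<le> 1" using nz nW by (simp add: c_def field_simps abs_le_iff)
    have "arccos c \<le> arcsin \<epsilon>" using le nW by (simp add: vec_angle_def c_def z_def)
    moreover have "arcsin \<epsilon> \<le> pi" "0 \<le> arccos c" "0 \<le> arcsin \<epsilon>" "arcsin \<epsilon> \<le> pi / 2"
      using \<epsilon> c1 arcsin_bounded[of \<epsilon>] arccos_bounded[of c] arcsin_le_arcsin[of 0 \<epsilon>]
      by (auto simp: abs_le_iff)
    ultimately have "cos (arcsin \<epsilon>) \<le> cos (arccos c)" by (intro cos_monotone_0_pi_le) auto
    then have ceq: "sqrt (1 - \<epsilon>\<^sup>2) \<le> c" using \<epsilon> c1 by (simp add: cos_arcsin abs_le_iff)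
    moreover have "0 \<le> sqrt (1 - \<epsilon>\<^sup>2)" using \<epsilon> by (simp add: power_le_one)
    ultimately have "(sqrt (1 - \<epsilon>\<^sup>2))\<^sup>2 \<le> c\<^sup>2" by (intro power_mono) auto
    then have c2: "1 - \<epsilon>\<^sup>2 \<le> c\<^sup>2" using \<epsilon> by (simp add: power_le_one)
    have ReW: "(Re (cnj V * z))\<^sup>2 = (c * norm z)\<^sup>2"
    proof -
      have "c * norm z = z \<bullet> W" using nz by (simp add: c_def)
      then show ?thesis using W by (auto simp: inner_complex_def power2_eq_square algebra_simps)
    qed
    have "(Re (cnj V * z))\<^sup>2 + (Im (cnj V * z))\<^sup>2 = (norm z)\<^sup>2"
      using V by (metis cmod_power2 complex_mod_cnj mult_1 norm_mult)
    then have "(Im (cnj V * z))\<^sup>2 = (1 - c\<^sup>2) * (norm z)\<^sup>2"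
      using ReW by (simp add: power_mult_distrib algebra_simps)
    also have "\<dots> \<le> \<epsilon>\<^sup>2 * (norm z)\<^sup>2" using c2 by (intro mult_right_mono) auto
    finally have "\<bar>Im (cnj V * z)\<bar>\<^sup>2 \<le> (\<epsilon> * norm z)\<^sup>2" by (simp add: power_mult_distrib)
    then show ?thesis using \<epsilon> unfolding z_def by (meson abs_le_square_iff mult_nonneg_nonneg norm_ge_zero order_less_imp_le power2_le_imp_le)
  qed simp
  have "closed {y. \<bar>Im (cnj V * (y - x))\<bar> \<le> \<epsilon> * norm (y - x)}"
    by (intro closed_Collect_le continuous_intros)
  then show ?thesis unfolding double_cone_def
    by (intro closure_minimal) (use * in auto)
qed

text \<open>A point of \<open>F\<close> off the thin slab drags along, by connectedness, a piece of \<open>F\<close> of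
  comparable content that stays outside a thin cone.\<close>

lemma geometric_tangent_imp_flat:
  fixes V x :: complex
  assumes tan: "geometric_tangent F x V" and F: "connected F" "x \<in> F"
    and V: "norm V = 1" and "0 < \<epsilon>"
  shows "\<exists>r0>0. \<forall>r P. 0 < r \<and> r < r0 \<and> P \<in> F \<and> dist P x < r \<longrightarrow> \<bar>Im (cnj V * (P - x))\<bar> \<le> \<epsilon> * r"
proof -
  \<comment> \<open>The cap keeps \<open>e/4\<close> below 1, as the cone estimate requires, and
    makes the radius \<open>e * r / 2\<close> used below smaller than r.\<close>
  define e where "e = min \<epsilon> (1/2)"
  have e: "0 < e" "e \<le> 1/2" "e \<le> \<epsilon>" using \<open>0 < \<epsilon>\<close> by (auto simp: e_def)
  define C where "C = double_cone x V (2 * arcsin (e/4))"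
  have "0 < arcsin (e/4)" using e arcsin_less_arcsin[of 0 "e/4"] by simp
  then have "((\<lambda>r. hausdorff_content1 ((F \<inter> ball x r) - C) / ennreal (2 * r)) \<longlongrightarrow> 0) (at_right 0)"
    using tan unfolding geometric_tangent_def C_def by simp
  then have "\<forall>\<^sub>F r in at_right 0. hausdorff_content1 ((F \<inter> ball x r) - C) / ennreal (2 * r) < ennreal (e/16)"
    using e by (intro order_tendstoD(2)[of _ 0]) auto
  then obtain r1 where r1: "r1 > 0"
    "\<And>r. 0 < r \<Longrightarrow> r < r1 \<Longrightarrow> hausdorff_content1 ((F \<inter> ball x r) - C) / ennreal (2 * r) < ennreal (e/16)"
    unfolding eventually_at_right_field by auto
  have "\<bar>Im (cnj V * (P - x))\<bar> \<le> \<epsilon> * r" if r: "0 < r" "r < r1 / 2" and P: "P \<in> F" "dist P x < r" for r P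
  proof (rule ccontr)
    assume "\<not> \<bar>Im (cnj V * (P - x))\<bar> \<le> \<epsilon> * r"
    moreover have "e * r \<le> \<epsilon> * r" using e r by simp
    ultimately have big: "\<bar>Im (cnj V * (P - x))\<bar> > e * r" by simp
    \<comment> \<open>Within \<open>\<eta>\<close> of P the deviation from the axis still exceeds
      \<open>\<eta>\<close>, whereas the thin cone allows at most
      \<open>(e/4) * (2 * r) = \<eta>\<close> inside the ball of radius 2r. At that radius the
      threshold \<open>e/16\<close> caps the content strictly below
      \<open>(e/16) * (4 * r) = \<eta>/2\<close>, which contradicts the lower bound by
      connectedness.\<close>
    define \<eta> where "\<eta> = e * r / 2"
    have \<eta>: "0 < \<eta>" "\<eta> < r" using e r by (auto simp: \<eta>_def field_simps)
    have "\<bar>Im (cnj V * (P - x))\<bar> \<le> dist P x"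
      using abs_Im_le_cmod[of "cnj V * (P - x)"] V by (simp add: norm_mult dist_norm)
    then have far: "\<eta> \<le> dist P x" using big \<eta> by (simp add: \<eta>_def)
    have "F \<inter> ball P \<eta> \<subseteq> (F \<inter> ball x (2 * r)) - C"
    proof
      fix Q assume Q: "Q \<in> F \<inter> ball P \<eta>"
      then have d: "dist P Q < \<eta>" by simp
      then have Qx: "dist Q x < 2 * r"
        using P \<eta> by (smt (verit) dist_commute dist_triangle)
      have "\<bar>Im (cnj V * (P - Q))\<bar> \<le> dist P Q"
        using abs_Im_le_cmod[of "cnj V * (P - Q)"] V by (simp add: norm_mult dist_norm)
      moreover have "Im (cnj V * (P - x)) = Im (cnj V * (P - Q)) + Im (cnj V * (Q - x))"
        by (simp add: algebra_simps)
      ultimately have "\<bar>Im (cnj V * (Q - x))\<bar> > \<eta>" using big d unfolding \<eta>_def by linarith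
      moreover have "e/4 * norm (Q - x) \<le> e / 4 * (2 * r)"
        using Qx e by (intro mult_left_mono) (auto simp: dist_norm)
      ultimately have "\<not> \<bar>Im (cnj V * (Q - x))\<bar> \<le> e/4 * norm (Q - x)" by (simp add: \<eta>_def)
      then have "Q \<notin> C" unfolding C_def using double_cone_subset_slab[OF V, of "e/4" x] e by auto
      then show "Q \<in> (F \<inter> ball x (2 * r)) - C" using Q Qx by (auto simp: dist_commute)
    qed
    then have "hausdorff_content1 (F \<inter> ball P \<eta>) \<le> hausdorff_content1 ((F \<inter> ball x (2 * r)) - C)"
      by (rule hausdorff_content1_mono)
    moreover have "ennreal \<eta> \<le> 2 * hausdorff_content1 (F \<inter> ball P \<eta>)"
      using \<eta> far by (intro hausdorff_content1_connected[OF F(1) P(1) F(2)]) auto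
    ultimately have 1: "ennreal \<eta> \<le> 2 * hausdorff_content1 ((F \<inter> ball x (2 * r)) - C)"
      by (meson mult_left_mono order_trans zero_le)
    have "hausdorff_content1 ((F \<inter> ball x (2 * r)) - C) / ennreal (2 * (2 * r)) < ennreal (e/16)"
      using r by (intro r1) auto
    then have "hausdorff_content1 ((F \<inter> ball x (2 * r)) - C) < ennreal (e/16) * ennreal (2 * (2 * r))"
      using r by (subst (asm) divide_less_ennreal) auto
    also have "\<dots> = ennreal (\<eta>/2)" using e r by (subst ennreal_mult[symmetric]) (auto simp: \<eta>_def)
    finally have "2 * hausdorff_content1 ((F \<inter> ball x (2 * r)) - C) < 2 * ennreal (\<eta>/2)"
      by (intro ennreal_mult_strict_left_mono) auto
    also have "\<dots> = ennreal \<eta>"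
      using \<eta> by (metis ennreal_mult ennreal_numeral field_sum_of_halves mult_2 zero_le_divide_iff zero_le_numeral order_less_imp_le)
    finally show False using 1 by simp
  qed
  then show ?thesis using r1(1) by (intro exI[of _ "r1/2"]) auto
qed

section \<open>Poisson summation for Gaussians\<close>

text \<open>A peaking kernel argument: D is orthogonal to all powers of \<open>kern\<close>, which
  are trigonometric polynomials concentrating at b. If D b were nonzero, the component of D along D
  b would be positive near b and, for a high power, the peak would outweigh everything else.\<close>

lemma zero_fourier_coefficients_imp_zero:
  fixes D :: "real \<Rightarrow> complex"
  assumes cont: "continuous_on {0..1} D"
    and coeffs: "\<And>m::int. integral {0..1} (\<lambda>a. D a * cis (2 * pi * m * a)) = 0"
    and b: "0 < b" "b < 1"
  shows "D b = 0"
proof (rule ccontr)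
  assume nz: "D b \<noteq> 0"
  \<comment> \<open>A 1-periodic kernel with maximum 1 at b and frequencies -1, 0, 1 only, so that
    multiplying by it merely mixes neighbouring Fourier coefficients.\<close>
  define kern where "kern a = (cos (pi * (a - b)))\<^sup>2" for a
  have contk: "continuous_on {0..1} kern" unfolding kern_def by (intro continuous_intros)
  have kern_cis: "complex_of_real (kern a) =
      1/2 + cis (- 2 * pi * b) / 4 * cis (2 * pi * a) + cis (2 * pi * b) / 4 * cis (- 2 * pi * a)" for a
  proof -
    have "kern a = 1/2 + cos (2 * (pi * (a - b))) / 2"
      unfolding kern_def cos_double_cos by (simp add: field_simps)
    moreover have "cis (- 2 * pi * b) * cis (2 * pi * a) = cis (2 * (pi * (a - b)))"
      "cis (2 * pi * b) * cis (- 2 * pi * a) = cis (- (2 * (pi * (a - b))))"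
      by (simp_all add: cis_mult algebra_simps)
    ultimately show ?thesis
      by (auto simp: complex_eq_iff field_simps)
  qed
  have trig: "integral {0..1} (\<lambda>a. D a * cis (2 * pi * m * a) * complex_of_real (kern a) ^ n) = 0" for n and m :: int
  proof (induction n arbitrary: m)
    case 0
    then show ?case using coeffs[of m] by simp
  next
    case (Suc n)
    define I where "I m a = D a * cis (2 * pi * m * a) * complex_of_real (kern a) ^ n" for m :: int and a
    have intI: "I m integrable_on {0..1}" for m unfolding I_def
      by (intro integrable_continuous_interval continuous_intros cont contk)
    have "D a * cis (2 * pi * m * a) * complex_of_real (kern a) ^ Suc n =
       1/2 * I m a + (cis (- 2 * pi * b) / 4) * I (m + 1) a + (cis (2 * pi * b) / 4) * I (m - 1) a" for a
    proof -
      have "cis (2 * pi * of_int (m + 1) * a) = cis (2 * pi * m * a) * cis (2 * pi * a)"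
         "cis (2 * pi * of_int (m - 1) * a) = cis (2 * pi * m * a) * cis (- 2 * pi * a)"
        by (simp_all add: cis_mult algebra_simps)
      then show ?thesis unfolding I_def power_Suc kern_cis by (simp only:) (simp add: algebra_simps)
    qed
    moreover have "integral {0..1} (\<lambda>a. 1/2 * I m a + (cis (- 2 * pi * b) / 4) * I (m + 1) a + (cis (2 * pi * b) / 4) * I (m - 1) a) = 0"
    proof -
      have I0: "(I m has_integral 0) {0..1}" for m
        using intI[of m] Suc[of m, folded I_def] by (metis integrable_integral)
      show ?thesis
        using has_integral_add[OF has_integral_add[OF has_integral_mult_right[OF I0[of m], of "1/2"]
            has_integral_mult_right[OF I0[of "m + 1"], of "cis (- 2 * pi * b) / 4"]]
            has_integral_mult_right[OF I0[of "m - 1"], of "cis (2 * pi * b) / 4"]]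
        by (simp add: integral_unique)
    qed
    ultimately show ?case by simp
  qed
  define u where "u a = Re (cnj (D b) * D a)" for a
  have contu: "continuous_on {0..1} u" unfolding u_def by (intro continuous_intros cont)
  have int0: "integral {0..1} (\<lambda>a. u a * kern a ^ n) = 0" for n
  proof -
    have bl: "bounded_linear (\<lambda>z. Re (cnj (D b) * z))"
      by (intro bounded_linear_compose[OF bounded_linear_Re] bounded_linear_mult_right)
    have "(\<lambda>a. D a * complex_of_real (kern a) ^ n) integrable_on {0..1}"
      by (intro integrable_continuous_interval continuous_intros cont contk)
    from integral_linear[OF this bl] trig[of 0 n]
    have "integral {0..1} (\<lambda>a. Re (cnj (D b) * (D a * complex_of_real (kern a) ^ n))) = 0"
      by (simp add: o_def)
    moreover have "Re (cnj (D b) * (D a * complex_of_real (kern a) ^ n)) = u a * kern a ^ n" for a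
      unfolding u_def by (simp flip: of_real_power add: algebra_simps)
    ultimately show ?thesis by simp
  qed
  define \<kappa> where "\<kappa> = u b / 2"
  have ub: "u b = (cmod (D b))\<^sup>2" unfolding u_def cmod_power2 by (simp add: power2_eq_square)
  then have \<kappa>: "\<kappa> > 0" "\<kappa> < u b" using nz by (auto simp: \<kappa>_def)
  have "isCont u b" using contu b by (intro continuous_on_interior[of "{0..1}"]) auto
  then obtain \<delta>0 where \<delta>0: "\<delta>0 > 0" "\<And>a. dist a b < \<delta>0 \<Longrightarrow> dist (u a) (u b) < \<kappa>"
    unfolding continuous_at_eps_delta using \<kappa> by (metis dist_commute)
  \<comment> \<open>Besides keeping the neighbourhood inside (0,1), the bounds by b and 1 - b give
    \<open>\<bar>a - b\<bar> \<le> 1 - \<delta>\<close> on the whole interval; so the kernel, which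
    peaks again at distance 1, stays below \<open>q1\<close> there too.\<close>
  define \<delta> where "\<delta> = min (\<delta>0/2) (min (b/2) ((1-b)/2))"
  have \<delta>: "0 < \<delta>" "\<delta> < \<delta>0" "\<delta> < b" "\<delta> < 1 - b" using \<delta>0 b by (auto simp: \<delta>_def min_def)
  have near: "u a \<ge> \<kappa>" if "\<bar>a - b\<bar> \<le> \<delta>" for a
  proof -
    have "\<bar>u a - u b\<bar> < \<kappa>" using \<delta>0(2)[of a] that \<delta> by (simp add: dist_real_def)
    then show ?thesis unfolding \<kappa>_def by linarith
  qed
  have "bounded (u ` {0..1})"
    by (intro compact_imp_bounded compact_continuous_image contu compact_Icc)
  then obtain M where M: "\<And>a. a \<in> {0..1} \<Longrightarrow> \<bar>u a\<bar> \<le> M" "M > 0"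
    unfolding bounded_pos by (metis image_eqI real_norm_def)
  define q0 where "q0 = (cos (pi * (\<delta>/2)))\<^sup>2"
  define q1 where "q1 = (cos (pi * \<delta>))\<^sup>2"
  have d12: "\<delta> < 1/2" using \<delta> by simp
  have cospos: "0 < cos (pi * \<delta>)" 
  proof (rule cos_gt_zero_pi)
    have "0 < pi * \<delta>" using \<delta> by simp
    then show "- (pi / 2) < pi * \<delta>" using pi_gt_zero by linarith
    show "pi * \<delta> < pi / 2" using d12 mult_strict_left_mono[OF d12 pi_gt_zero] by simp
  qed
  have cosless: "cos (pi * \<delta>) < cos (pi * (\<delta>/2))"
    using d12 \<delta> by (intro cos_monotone_0_pi) (auto simp: field_simps)
  have q: "0 < q1" "q1 < q0" unfolding q0_def q1_def
    using cospos cosless by (auto intro: power_strict_mono)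
  have kern_abs: "kern a = (cos (pi * \<bar>a - b\<bar>))\<^sup>2" for a
  proof -
    have "\<bar>pi * (a - b)\<bar> = pi * \<bar>a - b\<bar>" by (simp add: abs_mult)
    then show ?thesis unfolding kern_def by (metis cos_abs_real)
  qed
  have k0: "kern a \<ge> q0" if "\<bar>a - b\<bar> \<le> \<delta>/2" for a
  proof -
    have "kern a = (cos (pi * \<bar>a - b\<bar>))\<^sup>2" by (rule kern_abs)
    moreover have "cos (pi * (\<delta>/2)) \<le> cos (pi * \<bar>a - b\<bar>)"
      using that d12 \<delta> by (intro cos_monotone_0_pi_le mult_left_mono) (auto simp: field_simps)
    ultimately show ?thesis using cospos cosless unfolding q0_def by (auto intro!: power_mono)
  qed
  have k1: "kern a \<le> q1" if "\<bar>a - b\<bar> > \<delta>" "a \<in> {0..1}" for a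
  proof -
    have eq: "kern a = (cos (pi * \<bar>a - b\<bar>))\<^sup>2" by (rule kern_abs)
    have "cos (pi * \<bar>a - b\<bar>) \<le> cos (pi * \<delta>)"
      using that d12 \<delta> b by (intro cos_monotone_0_pi_le mult_left_mono) (auto simp: field_simps)
    moreover have "cos (pi * (1 - \<delta>)) \<le> cos (pi * \<bar>a - b\<bar>)"
      using that d12 \<delta> b by (intro cos_monotone_0_pi_le mult_left_mono) (auto simp: field_simps)
    moreover have "cos (pi * (1 - \<delta>)) = - cos (pi * \<delta>)" by (simp add: algebra_simps cos_diff)
    ultimately have "\<bar>cos (pi * \<bar>a - b\<bar>)\<bar> \<le> \<bar>cos (pi * \<delta>)\<bar>" by linarith
    then show ?thesis unfolding eq q1_def by (simp add: abs_le_square_iff)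
  qed
  have kern0: "kern a \<ge> 0" for a by (simp add: kern_def)
  \<comment> \<open>The vanishing integral is split three ways: at least
    \<open>\<kappa> * q0 ^ n\<close> on \<open>J\<close>, nonnegative on the rest of the
    \<open>\<delta>\<close>-neighbourhood, and at least \<open>- M * q1 ^ n\<close> away from it.
    Since \<open>q1 < q0\<close>, the resulting inequality fails for large n.\<close>
  have ineq: "\<kappa> * \<delta> * q0 ^ n \<le> M * q1 ^ n" for n
  proof -
    define J where "J = {b - \<delta>/2..b + \<delta>/2}"
    define L where "L a = (if a \<in> J then \<kappa> * q0 ^ n else 0) - M * q1 ^ n" for a
    have Jsub: "J \<subseteq> {0..1}" using \<delta> b by (auto simp: J_def)
    have "((\<lambda>a. \<kappa> * q0 ^ n) has_integral \<kappa> * q0 ^ n * \<delta>) J"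
      using has_integral_const_real[of "\<kappa> * q0 ^ n" "b - \<delta>/2" "b + \<delta>/2"] \<delta> by (simp add: J_def mult.commute)
    then have "((\<lambda>a. if a \<in> J then \<kappa> * q0 ^ n else 0) has_integral \<kappa> * q0 ^ n * \<delta>) {0..1}"
      using Jsub by (simp add: has_integral_restrict)
    then have L: "(L has_integral \<kappa> * q0 ^ n * \<delta> - M * q1 ^ n) {0..1}"
      unfolding L_def using has_integral_const_real[of "M * q1 ^ n" 0 1] by (intro has_integral_diff) auto
    have U: "((\<lambda>a. u a * kern a ^ n) has_integral 0) {0..1}"
    proof -
      have "(\<lambda>a. u a * kern a ^ n) integrable_on {0..1}"
        by (intro integrable_continuous_interval continuous_intros contu contk)
      then show ?thesis using int0[of n] by (metis integrable_integral)
    qed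
    have "L a \<le> u a * kern a ^ n" if a: "a \<in> {0..1}" for a
    proof (cases "\<bar>a - b\<bar> > \<delta>")
      case True
      then have "a \<notin> J" using \<delta> by (auto simp: J_def)
      moreover have "\<bar>u a * kern a ^ n\<bar> \<le> M * q1 ^ n"
        unfolding abs_mult using M(1)[OF a] k1[OF True a] kern0[of a] M(2)
        by (intro mult_mono) (auto intro: power_mono)
      ultimately show ?thesis by (auto simp: L_def)
    next
      case False
      have Mq: "M * q1 ^ n \<ge> 0" using M q by simp
      have "u a \<ge> \<kappa>" using near False by simp
      show ?thesis
      proof (cases "a \<in> J")
        case True
        then have "\<bar>a - b\<bar> \<le> \<delta>/2" unfolding J_def atLeastAtMost_iff by linarith
        then have "kern a ^ n \<ge> q0 ^ n" using k0 q by (intro power_mono) auto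
        then have "\<kappa> * q0 ^ n \<le> u a * kern a ^ n" using \<open>u a \<ge> \<kappa>\<close> \<kappa> q by (intro mult_mono) auto
        then show ?thesis using True Mq by (simp add: L_def)
      next
        case F2: False
        have "0 \<le> u a * kern a ^ n" using \<open>u a \<ge> \<kappa>\<close> \<kappa> kern0 by simp
        then show ?thesis using F2 Mq by (simp add: L_def)
      qed
    qed
    then have "\<kappa> * q0 ^ n * \<delta> - M * q1 ^ n \<le> 0" by (rule has_integral_le[OF L U])
    then show ?thesis by (simp add: algebra_simps)
  qed
  have "(\<lambda>n. M * (q1 / q0) ^ n) \<longlonglongrightarrow> M * 0"
    using q by (intro tendsto_intros LIMSEQ_realpow_zero) auto
  moreover have "\<kappa> * \<delta> > 0" using \<kappa> \<delta> by simp
  ultimately have "\<forall>\<^sub>F n in sequentially. M * (q1 / q0) ^ n < \<kappa> * \<delta>"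
    using order_tendstoD(2) by force
  then obtain n where n: "M * (q1 / q0) ^ n < \<kappa> * \<delta>" by (auto simp: eventually_sequentially)
  then have "M * q1 ^ n < \<kappa> * \<delta> * q0 ^ n" using q by (simp add: power_divide field_simps)
  with ineq[of n] show False by simp
qed

text \<open>The substitution \<open>c * x\<close> with c = sqrt (2 pi w) turns the integral into the
  characteristic function of the standard normal distribution at \<open>s\<close>.\<close>

lemma gaussian_fourier_integral:
  fixes w t :: real
  assumes w: "w > 0"
  shows "integrable lborel (\<lambda>x. complex_of_real (exp (- pi * w * x\<^sup>2)) * cis (2 * pi * t * x))" (is "integrable lborel ?G")
    and "(LINT x|lborel. complex_of_real (exp (- pi * w * x\<^sup>2)) * cis (2 * pi * t * x))
           = complex_of_real (exp (- pi * t\<^sup>2 / w) / sqrt w)"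
proof -
  define c where "c = sqrt (2 * pi * w)"
  have c: "c > 0" "c\<^sup>2 = 2 * pi * w" using w by (auto simp: c_def)
  define s where "s = 2 * pi * t / c"
  define H where "H x = complex_of_real (std_normal_density x) * cis (s * x)" for x
  have Hint: "integrable lborel H"
  proof (rule Bochner_Integration.integrable_bound)
    show "integrable lborel (\<lambda>x. std_normal_density x)" by (rule integrable_normal_density) simp
    show "H \<in> borel_measurable lborel" unfolding H_def std_normal_density_def
      by (auto intro!: borel_measurable_times borel_measurable_of_real borel_measurable_continuous_onI continuous_intros)
  qed (simp add: H_def norm_mult)
  have Hval: "integral\<^sup>L lborel H = complex_of_real (exp (- (s\<^sup>2) / 2))"
  proof -
    have "char std_normal_distribution s = integral\<^sup>L lborel (\<lambda>x. std_normal_density x *\<^sub>R iexp (s * x))"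
      unfolding char_def by (subst integral_density) (auto simp: normal_density_nonneg)
    also have "\<dots> = integral\<^sup>L lborel H"
      unfolding H_def by (simp add: cis_conv_exp scaleR_conv_of_real)
    finally show ?thesis by (simp add: char_std_normal_distribution)
  qed
  have HG: "?G x = sqrt (2 * pi) * H (0 + c * x)" for x
  proof -
    have "s * (c * x) = 2 * pi * t * x" using c by (simp add: s_def)
    moreover have "(c * x)\<^sup>2 / 2 = pi * w * x\<^sup>2" using c by (simp add: power_mult_distrib)
    moreover have "0 + c * x = c * x" by simp
    ultimately show ?thesis unfolding H_def std_normal_density_def by (simp only:) simp
  qed
  have "integrable lborel (\<lambda>x. H (0 + c * x))" 
    by (intro lborel_integrable_real_affine[OF Hint]) (use c in auto)
  then show "integrable lborel ?G" unfolding HG by (intro integrable_mult_right)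
  have "integral\<^sup>L lborel H = \<bar>c\<bar> *\<^sub>R integral\<^sup>L lborel (\<lambda>x. H (0 + c * x))"
    using c by (intro lborel_integral_real_affine) auto
  then have "integral\<^sup>L lborel (\<lambda>x. H (0 + c * x)) = complex_of_real (exp (- (s\<^sup>2) / 2) / c)"
    using c Hval by (simp add: scaleR_conv_of_real field_simps)
  then have "integral\<^sup>L lborel ?G = sqrt (2 * pi) * complex_of_real (exp (- (s\<^sup>2) / 2) / c)"
    unfolding HG by simp
  moreover have "s\<^sup>2 / 2 = pi * t\<^sup>2 / w" using c w by (simp add: s_def power_divide power_mult_distrib) (simp add: field_simps power2_eq_square)
  moreover have "c = sqrt (2 * pi) * sqrt w" unfolding c_def by (simp add: real_sqrt_mult)
  ultimately show "integral\<^sup>L lborel ?G = complex_of_real (exp (- pi * t\<^sup>2 / w) / sqrt w)"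
    by simp
qed

section \<open>Summability over the integers and termwise integration\<close>

lemma summable_inverse_int_square: "(\<lambda>k::int. 1 / (real_of_int k)\<^sup>2) summable_on UNIV"
proof -
  have s: "summable (\<lambda>n. 1 / (real n)\<^sup>2)" using inverse_power_summable[of 2, where ?'a = real] by (simp add: field_simps)
  then have n: "(\<lambda>n. 1 / (real n)\<^sup>2) summable_on UNIV"
    by (intro norm_summable_imp_summable_on) simp
  have "(\<lambda>k::int. 1 / (real_of_int k)\<^sup>2) summable_on range int"
    using n by (subst summable_on_reindex) (auto simp: o_def)
  moreover have "(\<lambda>k::int. 1 / (real_of_int k)\<^sup>2) summable_on range (\<lambda>n. - int n)"
    using n by (subst summable_on_reindex) (auto simp: o_def inj_on_def)
  ultimately have "(\<lambda>k::int. 1 / (real_of_int k)\<^sup>2) summable_on (range int \<union> range (\<lambda>n. - int n))"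
    by (rule summable_on_union)
  moreover have "range int \<union> range (\<lambda>n. - int n) = UNIV"
    by (auto simp: image_iff) (metis int_cases2)
  ultimately show ?thesis by simp
qed

lemma exp_minus_le_inverse: "0 < x \<Longrightarrow> exp (- x) \<le> 1 / (x::real)"
  using exp_ge_add_one_self[of x] by (simp add: exp_minus field_simps del: exp_ge_add_one_self)

lemma summable_gaussian_int:
  assumes c: "c > 0"
  shows "(\<lambda>k::int. exp (- c * (real_of_int k)\<^sup>2)) summable_on UNIV"
proof -
  have "(\<lambda>k::int. (1/c) * (1 / (real_of_int k)\<^sup>2)) summable_on UNIV - {0}"
    by (intro summable_on_cmult_right summable_on_subset_banach[OF summable_inverse_int_square]) auto
  then have "(\<lambda>k::int. exp (- c * (real_of_int k)\<^sup>2)) summable_on UNIV - {0}"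
  proof (rule summable_on_comparison_test)
    fix k :: int assume "k \<in> UNIV - {0}"
    then show "exp (- c * (real_of_int k)\<^sup>2) \<le> (1/c) * (1 / (real_of_int k)\<^sup>2)"
      using exp_minus_le_inverse[of "c * (real_of_int k)\<^sup>2"] c by (simp add: field_simps)
  qed simp
  then have "(\<lambda>k::int. exp (- c * (real_of_int k)\<^sup>2)) summable_on insert 0 (UNIV - {0})"
    by (subst summable_on_insert_iff)
  then show ?thesis by (simp add: insert_UNIV insert_Diff_if)
qed

lemma continuous_on_infsum:
  fixes h :: "'i \<Rightarrow> 'a::topological_space \<Rightarrow> 'c::banach"
  assumes le: "\<And>k x. x \<in> X \<Longrightarrow> norm (h k x) \<le> M k" and M: "M summable_on I"
    and cont: "\<And>k. continuous_on X (h k)"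
  shows "continuous_on X (\<lambda>x. \<Sum>\<^sub>\<infinity>k\<in>I. h k x)"
  by (rule uniform_limit_theorem[OF _ Weierstrass_m_test_general[OF le M]])
     (auto intro!: always_eventually continuous_intros cont)

lemma has_sum_integral:
  fixes h :: "'i \<Rightarrow> real \<Rightarrow> complex"
  assumes le: "\<And>k x. x \<in> {a..b} \<Longrightarrow> norm (h k x) \<le> M k" and M: "M summable_on I"
    and cont: "\<And>k. continuous_on {a..b} (h k)"
  shows "((\<lambda>k. integral {a..b} (h k)) has_sum integral {a..b} (\<lambda>x. \<Sum>\<^sub>\<infinity>k\<in>I. h k x)) I"
proof -
  have ul: "uniform_limit {a..b} (\<lambda>X x. \<Sum>k\<in>X. h k x) (\<lambda>x. \<Sum>\<^sub>\<infinity>k\<in>I. h k x) (finite_subsets_at_top I)"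
    by (rule Weierstrass_m_test_general[OF le M])
  have c: "\<And>X. continuous_on {a..b} (\<lambda>x. \<Sum>k\<in>X. h k x)" by (intro continuous_intros cont)
  obtain S J where SJ: "\<And>X. ((\<lambda>x. \<Sum>k\<in>X. h k x) has_integral S X) {a..b}"
    "((\<lambda>x. \<Sum>\<^sub>\<infinity>k\<in>I. h k x) has_integral J) {a..b}" "(S \<longlongrightarrow> J) (finite_subsets_at_top I)"
    by (rule uniform_limit_integral[OF ul c]) auto
  have "S X = (\<Sum>k\<in>X. integral {a..b} (h k))" if "finite X" for X
  proof -
    have "((\<lambda>x. \<Sum>k\<in>X. h k x) has_integral (\<Sum>k\<in>X. integral {a..b} (h k))) {a..b}"
      by (intro has_integral_sum that integrable_integral integrable_continuous_interval cont)
    then show ?thesis using SJ(1) has_integral_unique by blast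
  qed
  then have "\<forall>\<^sub>F X in finite_subsets_at_top I. S X = (\<Sum>k\<in>X. integral {a..b} (h k))"
    by (intro eventually_finite_subsets_at_top_weakI) auto
  then have "((\<lambda>X. \<Sum>k\<in>X. integral {a..b} (h k)) \<longlongrightarrow> J) (finite_subsets_at_top I)"
    using SJ(3) by (simp cong: tendsto_cong)
  then show ?thesis using SJ(2) unfolding has_sum_def by (simp add: integral_unique)
qed

text \<open>The half-open unit intervals with integer endpoints partition the line; enumerating them
  by \<open>int_decode\<close> makes countable additivity of the integral applicable.\<close>

lemma infsum_integral_unit_intervals:
  fixes G :: "real \<Rightarrow> complex"
  assumes G: "integrable lborel G"
    and s: "((\<lambda>k::int. integral {0..1} (\<lambda>a. G (real_of_int k + a))) has_sum J) UNIV"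
  shows "J = (LINT x|lborel. G x)"
proof -
  define A where "A i = {real_of_int (int_decode i)..<real_of_int (int_decode i) + 1}" for i
  have U: "(\<Union>i. A i) = UNIV"
  proof (intro equalityI subset_UNIV subsetI)
    fix x :: real
    have "x \<in> A (int_encode \<lfloor>x\<rfloor>)" unfolding A_def by simp
    then show "x \<in> (\<Union>i. A i)" by blast
  qed
  have disj: "A i \<inter> A j = {}" if "i \<noteq> j" for i j
  proof -
    have "int_decode i \<noteq> int_decode j" using that by (simp add: int_decode_eq)
    then show ?thesis unfolding A_def by (auto simp: disjoint_iff)
  qed
  have si: "set_integrable lborel S G" if "S \<in> sets borel" for S
    unfolding set_integrable_def using integrable_mult_indicator[OF _ G, of S] that by simp
  have "(LINT x:(\<Union>i. A i)|lborel. G x) = (\<Sum>i. (LINT x:(A i)|lborel. G x))"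
    by (intro lebesgue_integral_countable_add disj si) (auto simp: A_def)
  then have 1: "(LINT x|lborel. G x) = (\<Sum>i. (LINT x:(A i)|lborel. G x))"
    unfolding U by (simp add: set_lebesgue_integral_def)
  have 2: "(LINT x:(A i)|lborel. G x) = integral {0..1} (\<lambda>a. G (int_decode i + a))" for i
  proof -
    let ?k = "real_of_int (int_decode i)"
    have "(LINT x:(A i)|lborel. G x) = integral (A i) G"
      by (intro set_borel_integral_eq_integral si) (auto simp: A_def)
    also have "\<dots> = integral {?k..?k + 1} G" unfolding A_def
    proof (rule integral_subset_negligible)
      have "{?k..?k + 1} - {?k..<?k + 1} = {?k + 1}" by auto
      then show "negligible ({?k..?k + 1} - {?k..<?k + 1})" by simp
    qed auto
    also have "\<dots> = integral {0..1} (\<lambda>a. G (?k + a))"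
      using integral_shift_real_ivl[of "?k" "?k" "?k + 1" G] by (simp add: add.commute)
    finally show ?thesis .
  qed
  have "((\<lambda>i. integral {0..1} (\<lambda>a. G (int_decode i + a))) has_sum J) UNIV"
    using s has_sum_reindex_bij_betw[OF bij_int_decode, of "\<lambda>k. integral {0..1} (\<lambda>a. G (real_of_int k + a))" J] by simp
  then have "(\<lambda>i. integral {0..1} (\<lambda>a. G (int_decode i + a))) sums J" by (rule has_sum_imp_sums)
  then show ?thesis unfolding 1 2 by (simp add: sums_unique)
qed

lemma integral_cis_period:
  "integral {0..1} (\<lambda>a. cis (2 * pi * real_of_int m * a)) = (if m = 0 then 1 else 0)"
proof (cases "m = 0")
  case False
  have "integral {0..1} (\<lambda>a. exp ((2 * pi * m * \<i>) * complex_of_real a)) = (exp ((2 * pi * m * \<i>) * 1) - 1) / (2 * pi * m * \<i>)"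
    using False integral_exp[of 1 "2 * pi * m * \<i>"] by simp
  moreover have "exp ((2 * pi * m * \<i>) * complex_of_real a) = cis (2 * pi * m * a)" for a
    by (simp add: cis_conv_exp mult_ac)
  moreover have "exp ((2 * pi * m * \<i>) * 1) = 1"
    using cis_multiple_2pi[of "of_int m"] by (simp add: cis_conv_exp mult_ac)
  ultimately show ?thesis using False by simp
qed simp

section \<open>The Poisson summation formula\<close>

text \<open>Both sides are continuous in b and have the same Fourier coefficients: on the left the
  periodised integral unfolds to a Gaussian integral over the line, on the right orthogonality picks
  out one term.\<close>

lemma poisson_gaussian:
  fixes w b :: real
  assumes w: "w > 0" and b: "0 \<le> b" "b < 1"
  shows "(\<Sum>\<^sub>\<infinity>k\<in>(UNIV::int set). complex_of_real (exp (- pi * w * (real_of_int k + b)\<^sup>2))) =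
     (\<Sum>\<^sub>\<infinity>m\<in>(UNIV::int set). complex_of_real (exp (- pi * (real_of_int m)\<^sup>2 / w) / sqrt w) * cis (2 * pi * m * b))"
proof -
  define f where "f a = (\<Sum>\<^sub>\<infinity>k\<in>(UNIV::int set). complex_of_real (exp (- pi * w * (real_of_int k + a)\<^sup>2)))" for a
  define g where "g a = (\<Sum>\<^sub>\<infinity>m\<in>(UNIV::int set). complex_of_real (exp (- pi * (real_of_int m)\<^sup>2 / w) / sqrt w) * cis (2 * pi * m * a))" for a
  \<comment> \<open>A majorant from \<open>(k + a)\<^sup>2 \<ge> k\<^sup>2 / 2 - 1\<close>, uniform
    for a in [-1,1]. The interval extends below 0 so that continuity at 0 is available for the
    endpoint case.\<close>
  define M where "M k = exp (pi * w) * exp (- (pi * w / 2) * (real_of_int k)\<^sup>2)" for k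
  define N where "N m = 1 / sqrt w * exp (- (pi / w) * (real_of_int m)\<^sup>2)" for m
  have M: "M summable_on UNIV" unfolding M_def using w
    by (intro summable_on_cmult_right summable_gaussian_int) auto
  have N: "N summable_on UNIV" unfolding N_def using w
    by (intro summable_on_cmult_right summable_gaussian_int) auto
  have fle: "exp (- pi * w * (real_of_int k + a)\<^sup>2) \<le> M k" if "a \<in> {-1..1}" for k :: int and a :: real
  proof -
    have "a\<^sup>2 \<le> 1" using that by (simp add: abs_square_le_1 abs_le_iff)
    moreover have "0 \<le> (k + 2 * a)\<^sup>2" by simp
    ultimately have "real_of_int k ^ 2 / 2 - 1 \<le> (real_of_int k + a)\<^sup>2" by (simp add: power2_eq_square algebra_simps)
    then have "(pi * w) * (real_of_int k ^ 2 / 2 - 1) \<le> (pi * w) * (real_of_int k + a)\<^sup>2"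
      using w by (intro mult_left_mono) auto
    then show ?thesis unfolding M_def by (simp add: algebra_simps flip: exp_add)
  qed
  have fle': "norm (complex_of_real (exp (- pi * w * (real_of_int k + a)\<^sup>2)) * cis s) \<le> M k" if "a \<in> {-1..1}" for k :: int and a s :: real
    using fle[OF that] by (simp add: norm_mult)
  have gle: "norm (complex_of_real (exp (- pi * (real_of_int m)\<^sup>2 / w) / sqrt w) * cis s) \<le> N m" for m :: int and s
    using w by (simp add: N_def norm_mult norm_divide field_simps)
  have gle2: "norm (complex_of_real (exp (- pi * (real_of_int m)\<^sup>2 / w) / sqrt w) * cis s * cis t) \<le> N m" for m :: int and s t
    using gle[of m s] by (simp only: norm_mult norm_cis mult_1_right)
  have contf: "continuous_on {-1..1} f" unfolding f_def
  proof (rule continuous_on_infsum[OF _ M])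
    show "cmod (complex_of_real (exp (- pi * w * (real_of_int k + x)\<^sup>2))) \<le> M k" if "x \<in> {-1..1}" for k :: int and x :: real
      using fle'[OF that, of k 0] by simp
  qed (intro continuous_intros)
  have contg: "continuous_on X g" for X unfolding g_def
    by (rule continuous_on_infsum[OF _ N]) (rule gle, intro continuous_intros)
  have f_per: "f (a + 1) = f a" for a
    unfolding f_def using infsum_reindex_bij_betw[of "\<lambda>k. k + 1" UNIV UNIV "\<lambda>k::int. complex_of_real (exp (- pi * w * (real_of_int k + a)\<^sup>2))"]
    by (simp add: algebra_simps bij_plus_right)
  have cis_per: "cis (2 * pi * m * (a + 1)) = cis (2 * pi * m * a)" for m :: int and a :: real
    by (simp add: distrib_left cis_multiple_2pi flip: cis_mult)
  have g_per: "g (a + 1) = g a" for a unfolding g_def by (simp only: cis_per)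
  have fcoef: "integral {0..1} (\<lambda>a. f a * cis (2 * pi * m * a)) = complex_of_real (exp (- pi * (real_of_int m)\<^sup>2 / w) / sqrt w)" for m :: int
  proof -
    define G where "G x = complex_of_real (exp (- pi * w * x\<^sup>2)) * cis (2 * pi * m * x)" for x
    have cis_shift: "cis (2 * pi * m * (real_of_int k + a)) = cis (2 * pi * m * a)" for k :: int and a :: real
    proof -
      have "2 * pi * m * (k + a) = 2 * pi * of_int (m * k) + 2 * pi * m * a" by (simp add: algebra_simps)
      then show ?thesis by (simp only: cis_mult[symmetric] cis_multiple_2pi[of "of_int (m * k)"]) (simp add: cis_multiple_2pi)
    qed
    have Gk: "G (real_of_int k + a) = complex_of_real (exp (- pi * w * (real_of_int k + a)\<^sup>2)) * cis (2 * pi * m * a)" for k :: int and a :: real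
      unfolding G_def cis_shift ..
    have "((\<lambda>k::int. integral {0..1} (\<lambda>a. G (real_of_int k + a))) has_sum
       integral {0..1} (\<lambda>a. \<Sum>\<^sub>\<infinity>k\<in>(UNIV::int set). G (real_of_int k + a))) UNIV"
    proof (rule has_sum_integral[OF _ M])
      show "cmod (G (real_of_int k + x)) \<le> M k" if "x \<in> {0..1}" for k :: int and x :: real
        unfolding Gk using that by (intro fle') auto
      show "continuous_on {0..1} (\<lambda>a. G (real_of_int k + a))" for k :: int
        unfolding G_def by (intro continuous_intros)
    qed
    then have "integral {0..1} (\<lambda>a. \<Sum>\<^sub>\<infinity>k\<in>(UNIV::int set). G (real_of_int k + a)) = (LINT x|lborel. G x)"
      unfolding G_def by (intro infsum_integral_unit_intervals gaussian_fourier_integral w)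
    also have "\<dots> = complex_of_real (exp (- pi * (real_of_int m)\<^sup>2 / w) / sqrt w)"
      unfolding G_def by (rule gaussian_fourier_integral[OF w])
    also have "(\<lambda>a. \<Sum>\<^sub>\<infinity>k\<in>(UNIV::int set). G (real_of_int k + a)) = (\<lambda>a. f a * cis (2 * pi * m * a))"
      unfolding Gk f_def by (simp add: infsum_cmult_left')
    finally show ?thesis .
  qed
  have gcoef: "integral {0..1} (\<lambda>a. g a * cis (2 * pi * m * a)) = complex_of_real (exp (- pi * (real_of_int m)\<^sup>2 / w) / sqrt w)" for m :: int
  proof -
    let ?c = "\<lambda>l::int. complex_of_real (exp (- pi * (real_of_int l)\<^sup>2 / w) / sqrt w)"
    have hs: "((\<lambda>l. integral {0..1} (\<lambda>a. ?c l * cis (2 * pi * l * a) * cis (2 * pi * m * a))) has_sum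
       integral {0..1} (\<lambda>a. \<Sum>\<^sub>\<infinity>l\<in>(UNIV::int set). ?c l * cis (2 * pi * l * a) * cis (2 * pi * m * a))) UNIV"
      by (rule has_sum_integral[OF _ N]) (rule gle2, intro continuous_intros)
    \<comment> \<open>Only l = -m survives, and the coefficient is even in l.\<close>
    have "integral {0..1} (\<lambda>a. ?c l * cis (2 * pi * l * a) * cis (2 * pi * m * a)) = (if l = - m then ?c l else 0)" for l
    proof -
      have "?c l * cis (2 * pi * l * a) * cis (2 * pi * m * a) = ?c l * cis (2 * pi * of_int (l + m) * a)" for a
        by (simp add: mult.assoc cis_mult) (simp add: algebra_simps)
      then have "integral {0..1} (\<lambda>a. ?c l * cis (2 * pi * l * a) * cis (2 * pi * m * a)) = ?c l * (if l + m = 0 then 1 else 0)"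
        by (simp only: integral_mult_right integral_cis_period)
      then show ?thesis by auto
    qed
    with hs have "((\<lambda>l. if l = - m then ?c l else 0) has_sum
       integral {0..1} (\<lambda>a. \<Sum>\<^sub>\<infinity>l\<in>(UNIV::int set). ?c l * cis (2 * pi * l * a) * cis (2 * pi * m * a))) UNIV" by simp
    moreover have "((\<lambda>l. if l = - m then ?c l else 0) has_sum ?c (- m)) UNIV"
      by (rule has_sum_finite_neutralI[of "{-m}"]) auto
    ultimately have "integral {0..1} (\<lambda>a. \<Sum>\<^sub>\<infinity>l\<in>(UNIV::int set). ?c l * cis (2 * pi * l * a) * cis (2 * pi * m * a)) = ?c (- m)"
      by (rule has_sum_unique)
    moreover have "(\<Sum>\<^sub>\<infinity>l\<in>(UNIV::int set). ?c l * cis (2 * pi * l * a) * cis (2 * pi * m * a)) = g a * cis (2 * pi * m * a)" for a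
      unfolding g_def by (rule infsum_cmult_left')
    ultimately show ?thesis by simp
  qed
  have eq: "f a = g a" if a: "0 < a" "a < 1" for a
  proof -
    have cf: "continuous_on {0..1} f" by (rule continuous_on_subset[OF contf]) auto
    have "f a - g a = 0"
    proof (rule zero_fourier_coefficients_imp_zero[where D = "\<lambda>a. f a - g a"])
      show "continuous_on {0..1} (\<lambda>a. f a - g a)" by (intro continuous_intros contg cf)
      fix m :: int
      have "(\<lambda>a. f a * cis (2 * pi * m * a)) integrable_on {0..1}"
        "(\<lambda>a. g a * cis (2 * pi * m * a)) integrable_on {0..1}"
        by (intro integrable_continuous_interval continuous_intros cf contg)+
      then show "integral {0..1} (\<lambda>a. (f a - g a) * cis (2 * pi * m * a)) = 0"
        by (simp add: left_diff_distrib integral_diff fcoef gcoef)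
    qed (use a in auto)
    then show ?thesis by simp
  qed
  have "f b = g b"
  proof (cases "b = 0")
    case False
    then show ?thesis using eq b by simp
  next
    case True
    \<comment> \<open>Uniqueness covers only interior points; b = 0 is reached as a one-sided
      limit.\<close>
    have "isCont f 0" "isCont g 0" using contf contg[of UNIV] by (auto intro: continuous_on_interior simp: continuous_on_eq_continuous_at)
    then have lim: "(f \<longlongrightarrow> f 0) (at_right 0)" "(g \<longlongrightarrow> g 0) (at_right 0)"
      by (auto simp: isCont_def intro: filterlim_at_within_If tendsto_within_subset)
    have "\<forall>\<^sub>F a in at_right 0. f a = g a"
      unfolding eventually_at_right_field using eq by (intro exI[of _ 1]) auto
    then have "(g \<longlongrightarrow> f 0) (at_right 0)" using lim(1) by (simp cong: tendsto_cong)
    then show ?thesis using True lim(2) tendsto_unique trivial_limit_at_right_real by blast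
  qed
  then show ?thesis unfolding f_def g_def .
qed

section \<open>Theta series with periodic coefficients\<close>

lemma summable_on_norm_le:
  fixes f :: "'i \<Rightarrow> 'a::banach"
  assumes "g summable_on A" "\<And>x. x \<in> A \<Longrightarrow> norm (f x) \<le> g x"
  shows "f summable_on A"
  by (rule abs_summable_summable, rule summable_on_comparison_test[OF assms]) auto

lemma infsum_finite_sum:
  fixes f :: "'i \<Rightarrow> 'k \<Rightarrow> 'a::{topological_comm_monoid_add, t2_space}"
  assumes I: "finite I" and f: "\<And>i. i \<in> I \<Longrightarrow> f i summable_on A"
  shows "(\<Sum>\<^sub>\<infinity>x\<in>A. \<Sum>i\<in>I. f i x) = (\<Sum>i\<in>I. infsum (f i) A)"
proof -
  have "((\<lambda>x. \<Sum>i\<in>I. f i x) has_sum (\<Sum>i\<in>I. infsum (f i) A)) A"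
    using I f by (induction rule: finite_induct) (auto intro!: has_sum_add has_sum_infsum)
  then show ?thesis by (rule infsumI)
qed

section \<open>The once integrated theta series on the closed right half-plane\<close>

text \<open>The term \<open>k = 0\<close> vanishes because of the convention \<open>x / 0 = 0\<close>.\<close>

definition gauss_series :: "(int \<Rightarrow> complex) \<Rightarrow> complex \<Rightarrow> complex" where
  "gauss_series c w = (\<Sum>\<^sub>\<infinity>k. c k * exp (- (of_real pi * (of_int k)\<^sup>2 * w)) / (of_real pi * (of_int k)\<^sup>2))"

text \<open>The value is 2 zeta(2) / pi = pi / 3, with zero contribution from k = 0 by division by
  zero. It bounds \<open>gauss_series\<close> uniformly when the coefficients have modulus at most
  1.\<close>

definition inv_square_sum :: real where
  "inv_square_sum = (\<Sum>\<^sub>\<infinity>k::int. 1 / (pi * (of_int k)\<^sup>2))"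

lemma summable_inv_square: "(\<lambda>k::int. B * (1 / (pi * (real_of_int k)\<^sup>2))) summable_on UNIV"
  using summable_on_cmult_right[OF summable_inverse_int_square, of "B / pi"] by (simp add: field_simps)

lemma inv_square_sum_pos: "inv_square_sum > 0"
proof -
  have "(\<Sum>k\<in>{1::int}. 1 / (pi * (of_int k)\<^sup>2)) \<le> inv_square_sum"
    unfolding inv_square_sum_def using summable_inv_square[of 1]
    by (intro finite_sum_le_infsum) auto
  moreover have "0 < (\<Sum>k\<in>{1::int}. 1 / (pi * (of_int k)\<^sup>2))" by simp
  ultimately show ?thesis by linarith
qed

lemma norm_gauss_term_le:
  assumes "norm (c k) \<le> B" "0 \<le> Re w"
  shows "norm (c k * exp (- (of_real pi * (of_int k)\<^sup>2 * w)) / (of_real pi * (of_int k)\<^sup>2)) \<le> B * (1 / (pi * (real_of_int k)\<^sup>2))"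
proof -
  have "Re (of_real pi * (of_int k)\<^sup>2 * w) = pi * (real_of_int k)\<^sup>2 * Re w"
    by (simp flip: of_int_power)
  then have "norm (exp (- (of_real pi * (of_int k)\<^sup>2 * w))) \<le> 1" using assms(2) by simp
  then have "norm (c k) * norm (exp (- (of_real pi * (of_int k)\<^sup>2 * w))) \<le> B * 1"
    using assms(1) by (intro mult_mono) (auto intro: order_trans[OF norm_ge_zero])
  moreover have "norm (complex_of_real pi * (of_int k)\<^sup>2) = pi * (real_of_int k)\<^sup>2"
    by (simp add: norm_mult norm_power)
  ultimately show ?thesis by (simp add: norm_mult norm_divide divide_right_mono)
qed

lemma norm_gauss_series_le:
  assumes "\<And>k. norm (c k) \<le> B" "0 \<le> Re w"
  shows "norm (gauss_series c w) \<le> B * inv_square_sum"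
proof -
  have "((\<lambda>k. c k * exp (- (of_real pi * (of_int k)\<^sup>2 * w)) / (of_real pi * (of_int k)\<^sup>2)) has_sum gauss_series c w) UNIV"
    unfolding gauss_series_def
    by (intro has_sum_infsum summable_on_norm_le[OF summable_inv_square[of B]] norm_gauss_term_le assms)
  then have "norm (gauss_series c w) \<le> (\<Sum>\<^sub>\<infinity>k::int. B * (1 / (pi * (real_of_int k)\<^sup>2)))"
    by (rule norm_infsum_le[OF _ has_sum_infsum[OF summable_inv_square]]) (intro norm_gauss_term_le assms)
  also have "\<dots> = B * inv_square_sum"
    unfolding inv_square_sum_def by (rule infsum_cmult_right')
  finally show ?thesis .
qed

lemma continuous_on_gauss_series:
  assumes "\<And>k. norm (c k) \<le> B"
  shows "continuous_on {w. 0 \<le> Re w} (gauss_series c)"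
proof -
  have "continuous_on {w. 0 \<le> Re w} (\<lambda>w. gauss_series c w)"
    unfolding gauss_series_def
  proof (rule continuous_on_infsum[OF _ summable_inv_square[of B]])
    show "continuous_on {w. 0 \<le> Re w} (\<lambda>w. c k * exp (- (of_real pi * (of_int k)\<^sup>2 * w)) / (of_real pi * (of_int k)\<^sup>2))" for k
      by (cases "k = 0") (auto intro!: continuous_intros)
  qed (use assms norm_gauss_term_le in auto)
  then show ?thesis by simp
qed

text \<open>Uniform convergence of holomorphic partial sums on a disc inside the half-plane permits
  termwise differentiation. The derivative is minus the theta series without its k = 0 term; adding
  \<open>c 0\<close> restores the full series.\<close>

lemma has_field_derivative_gauss_series:
  assumes c: "\<And>k. norm (c k) \<le> B" and w: "0 < Re w"
  shows "(gauss_series c has_field_derivative c 0 - (\<Sum>\<^sub>\<infinity>k. c k * exp (- (of_real pi * (of_int k)\<^sup>2 * w)))) (at w)"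
proof -
  define h where "h k w = c k * exp (- (of_real pi * (of_int k)\<^sup>2 * w)) / (of_real pi * (of_int k)\<^sup>2)" for k w
  define h' where "h' k w = (if k = 0 then 0 else - c k * exp (- (of_real pi * (of_int k)\<^sup>2 * w)))" for k w
  define r where "r = Re w / 2"
  have r: "r > 0" using w by (simp add: r_def)
  have sub: "0 \<le> Re z" if "z \<in> cball w r" for z
  proof -
    have "\<bar>Re (w - z)\<bar> \<le> r" using that abs_Re_le_cmod[of "w - z"] by (simp add: dist_norm)
    then show ?thesis unfolding r_def minus_complex.simps using w by linarith
  qed
  have der: "(h k has_field_derivative h' k z) (at z)" for k z
    unfolding h_def h'_def by (cases "k = 0") (auto intro!: derivative_eq_intros)
  have ul: "uniform_limit (cball w r) (\<lambda>X z. \<Sum>k\<in>X. h k z) (\<lambda>z. \<Sum>\<^sub>\<infinity>k. h k z) (finite_subsets_at_top UNIV)"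
    unfolding h_def
    by (rule Weierstrass_m_test_general[OF _ summable_inv_square[of B]])
       (use c sub norm_gauss_term_le in auto)
  have gs: "(\<lambda>z. \<Sum>\<^sub>\<infinity>k. h k z) = gauss_series c" by (simp add: h_def gauss_series_def fun_eq_iff)
  have ev: "\<forall>\<^sub>F X in finite_subsets_at_top UNIV. continuous_on (cball w r) (\<lambda>z. \<Sum>k\<in>X. h k z) \<and>
      (\<forall>z\<in>ball w r. ((\<lambda>z. \<Sum>k\<in>X. h k z) has_field_derivative (\<Sum>k\<in>X. h' k z)) (at z))"
  proof (intro always_eventually allI conjI ballI)
    fix X show "continuous_on (cball w r) (\<lambda>z. \<Sum>k\<in>X. h k z)"
      by (intro continuous_on_sum DERIV_continuous_on[where D = "h' _"]) (auto intro: has_field_derivative_at_within der)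
    show "((\<lambda>z. \<Sum>k\<in>X. h k z) has_field_derivative (\<Sum>k\<in>X. h' k z)) (at z)" for z
      by (intro DERIV_sum der)
  qed
  obtain g' where g': "\<And>z. z \<in> ball w r \<Longrightarrow> (gauss_series c has_field_derivative g' z) (at z) \<and>
      ((\<lambda>X. \<Sum>k\<in>X. h' k z) \<longlongrightarrow> g' z) (finite_subsets_at_top UNIV)"
    using has_complex_derivative_uniform_limit[OF ev ul[unfolded gs] _ r] by (metis finite_subsets_at_top_neq_bot)
  have "((\<lambda>k. h' k w) has_sum g' w) UNIV" unfolding has_sum_def using g'[of w] r by simp
  moreover have "((\<lambda>k. if k = 0 then c 0 else 0) has_sum c 0) UNIV"
    by (rule has_sum_finite_neutralI[of "{0}"]) auto
  ultimately have "((\<lambda>k. (if k = 0 then c 0 else 0) + - h' k w) has_sum c 0 + - g' w) UNIV"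
    by (intro has_sum_add has_sum_uminusI) auto
  moreover have "(if k = 0 then c 0 else 0) + - h' k w = c k * exp (- (of_real pi * (of_int k)\<^sup>2 * w))" for k
    by (simp add: h'_def)
  ultimately have "(\<Sum>\<^sub>\<infinity>k. c k * exp (- (of_real pi * (of_int k)\<^sup>2 * w))) = c 0 + - g' w"
    by (simp add: infsumI)
  then show ?thesis using g'[of w] r by simp
qed

lemma holomorphic_on_gauss_series:
  assumes "\<And>k. norm (c k) \<le> B"
  shows "gauss_series c holomorphic_on {w. 0 < Re w}"
  unfolding holomorphic_on_def field_differentiable_def
  using has_field_derivative_gauss_series[where c = c, OF assms] has_field_derivative_at_within by blast

section \<open>Gauss sums and the theta transformation\<close>

text \<open>The unnormalised finite Fourier transform of the coefficients; for quadratic phases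
  these are the quadratic Gauss sums.\<close>

definition gauss_sum :: "nat \<Rightarrow> (int \<Rightarrow> complex) \<Rightarrow> int \<Rightarrow> complex" where
  "gauss_sum N a m = (\<Sum>r<N. a (int r) * cis (2 * pi * m * r / N))"

lemma bij_betw_residue_quotient:
  assumes "N > 0"
  shows "bij_betw (\<lambda>(r, j). int N * j + int r) ({..<N} \<times> UNIV) UNIV"
proof (rule bij_betwI[where g = "\<lambda>k. (nat (k mod int N), k div int N)"])
  show "(\<lambda>k. (nat (k mod int N), k div int N)) \<in> UNIV \<rightarrow> {..<N} \<times> UNIV"
    using assms by (auto simp: nat_less_iff)
qed (use assms in auto)

text \<open>Writing k = N j + r, each residue class is a Gaussian sum with parameter N^2 w shifted
  by r/N. Poisson summation turns the shift into the phase \<open>cis (2 * pi * m * r / N)\<close>,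
  and the sum over r assembles the Gauss sum.\<close>

lemma theta_transformation:
  assumes N: "N > 0" and per: "\<And>k. a (k + int N) = a k" and a: "\<And>k. norm (a k) \<le> 1" and w: "w > 0"
  shows "(\<Sum>\<^sub>\<infinity>k. a k * exp (- (of_real pi * (of_int k)\<^sup>2 * complex_of_real w))) =
     (\<Sum>\<^sub>\<infinity>m. gauss_sum N a m * exp (- (of_real pi * (of_int m)\<^sup>2 * (1 / (of_nat N ^ 2 * complex_of_real w))))) / (of_nat N * complex_of_real (sqrt w))"
proof -
  define f where "f k = a k * exp (- (of_real pi * (of_int k)\<^sup>2 * complex_of_real w))" for k
  define L where "L = (real N)\<^sup>2 * w"
  have L: "L > 0" using N w by (simp add: L_def)
  define E where "E m = exp (- pi * (real_of_int m)\<^sup>2 / L) / sqrt L" for m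
  have E0: "\<bar>E m\<bar> = E m" for m using L by (simp add: E_def)
  have Es: "E summable_on UNIV"
    using summable_on_cmult_right[OF summable_gaussian_int[of "pi / L"], of "1 / sqrt L"] L
    by (simp add: E_def[abs_def])
  have per': "a (int N * j + int r) = a (int r)" for j r
  proof (induction j rule: int_induct[where k = 0])
    case (step1 i)
    then show ?case using per[of "int N * i + int r"] by (simp add: algebra_simps)
  next
    case (step2 i)
    then show ?case using per[of "int N * (i - 1) + int r"] by (simp add: algebra_simps)
  qed simp
  have normf: "norm (f k) \<le> exp (- (pi * w) * (real_of_int k)\<^sup>2)" for k
  proof -
    have "- (of_real pi * (of_int k)\<^sup>2 * complex_of_real w) = complex_of_real (- (pi * w) * (real_of_int k)\<^sup>2)" by simp
    then have "norm (exp (- (of_real pi * (of_int k)\<^sup>2 * complex_of_real w))) = exp (- (pi * w) * (real_of_int k)\<^sup>2)"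
      by (simp only: norm_exp_eq_Re Re_complex_of_real)
    then have "norm (f k) = norm (a k) * exp (- (pi * w) * (real_of_int k)\<^sup>2)"
      unfolding f_def norm_mult by (rule arg_cong)
    also have "\<dots> \<le> 1 * exp (- (pi * w) * (real_of_int k)\<^sup>2)" by (intro mult_right_mono a) simp
    finally show ?thesis by simp
  qed
  have fs: "f summable_on UNIV"
    by (rule summable_on_norm_le[OF summable_gaussian_int normf]) (use w in auto)
  have "infsum f UNIV = (\<Sum>\<^sub>\<infinity>(r, j)\<in>{..<N} \<times> UNIV. f (int N * j + int r))"
    using infsum_reindex_bij_betw[OF bij_betw_residue_quotient[OF N], of f] by (simp add: case_prod_unfold)
  also have "\<dots> = (\<Sum>\<^sub>\<infinity>r\<in>{..<N}. \<Sum>\<^sub>\<infinity>j. f (int N * j + int r))"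
  proof (rule infsum_Sigma'_banach[symmetric])
    show "(\<lambda>(r, j). f (int N * j + int r)) summable_on {..<N} \<times> UNIV"
      using summable_on_reindex_bij_betw[OF bij_betw_residue_quotient[OF N], of f] fs by (simp add: case_prod_unfold)
  qed
  also have "\<dots> = (\<Sum>r<N. \<Sum>\<^sub>\<infinity>j. f (int N * j + int r))" by simp
  also have "\<dots> = (\<Sum>r<N. a (int r) * (\<Sum>\<^sub>\<infinity>m. complex_of_real (E m) * cis (2 * pi * of_int m * (real r / real N))))"
  proof (intro sum.cong refl)
    fix r assume r: "r \<in> {..<N}"
    have "f (int N * j + int r) = a (int r) * complex_of_real (exp (- pi * L * (real_of_int j + real r / real N)\<^sup>2))" for j
    proof -
      have "pi * (real_of_int (int N * j + int r))\<^sup>2 * w = pi * L * (real_of_int j + real r / real N)\<^sup>2"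
        using N unfolding L_def by (simp add: field_simps power2_eq_square)
      then have "- (of_real pi * (of_int (int N * j + int r))\<^sup>2 * complex_of_real w) = complex_of_real (- pi * L * (real_of_int j + real r / real N)\<^sup>2)"
        by (metis (no_types, lifting) mult_minus_left of_real_minus of_real_mult of_real_of_int_eq of_real_power)
      then show ?thesis unfolding f_def per' by (metis exp_of_real)
    qed
    then have "(\<Sum>\<^sub>\<infinity>j. f (int N * j + int r)) = a (int r) * (\<Sum>\<^sub>\<infinity>j. complex_of_real (exp (- pi * L * (real_of_int j + real r / real N)\<^sup>2)))"
      by (simp only: infsum_cmult_right')
    also have "(\<Sum>\<^sub>\<infinity>j. complex_of_real (exp (- pi * L * (real_of_int j + real r / real N)\<^sup>2))) =
        (\<Sum>\<^sub>\<infinity>m. complex_of_real (E m) * cis (2 * pi * of_int m * (real r / real N)))"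
      unfolding E_def by (rule poisson_gaussian[OF L]) (use r in auto)
    finally show "(\<Sum>\<^sub>\<infinity>j. f (int N * j + int r)) = a (int r) * (\<Sum>\<^sub>\<infinity>m. complex_of_real (E m) * cis (2 * pi * of_int m * (real r / real N)))" .
  qed
  also have "\<dots> = (\<Sum>r<N. \<Sum>\<^sub>\<infinity>m. a (int r) * (complex_of_real (E m) * cis (2 * pi * of_int m * (real r / real N))))"
    by (simp only: infsum_cmult_right')
  also have "\<dots> = (\<Sum>\<^sub>\<infinity>m. \<Sum>r<N. a (int r) * (complex_of_real (E m) * cis (2 * pi * of_int m * (real r / real N))))"
  proof (rule infsum_finite_sum[symmetric])
    fix r
    show "(\<lambda>m. a (int r) * (complex_of_real (E m) * cis (2 * pi * of_int m * (real r / real N)))) summable_on UNIV"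
    proof (rule summable_on_cmult_right, rule summable_on_norm_le[OF Es])
      show "norm (complex_of_real (E m) * cis (2 * pi * of_int m * (real r / real N))) \<le> E m" for m
        by (simp only: norm_mult norm_cis norm_of_real E0)
    qed
  qed simp
  also have "\<dots> = (\<Sum>\<^sub>\<infinity>m. gauss_sum N a m * exp (- (of_real pi * (of_int m)\<^sup>2 * (1 / (of_nat N ^ 2 * complex_of_real w)))) * (1 / (of_nat N * complex_of_real (sqrt w))))"
  proof (intro infsum_cong)
    fix m :: int
    have "- (of_real pi * (of_int m)\<^sup>2 * (1 / (of_nat N ^ 2 * complex_of_real w))) = complex_of_real (- pi * (real_of_int m)\<^sup>2 / L)"
      unfolding L_def by simp
    then have "exp (- (of_real pi * (of_int m)\<^sup>2 * (1 / (of_nat N ^ 2 * complex_of_real w)))) = complex_of_real (exp (- pi * (real_of_int m)\<^sup>2 / L))"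
      by (metis exp_of_real)
    moreover have "complex_of_real (sqrt L) = of_nat N * complex_of_real (sqrt w)" unfolding L_def by (simp add: real_sqrt_mult)
    ultimately have "complex_of_real (E m) = exp (- (of_real pi * (of_int m)\<^sup>2 * (1 / (of_nat N ^ 2 * complex_of_real w)))) * (1 / (of_nat N * complex_of_real (sqrt w)))"
      unfolding E_def by simp
    then show "(\<Sum>r<N. a (int r) * (complex_of_real (E m) * cis (2 * pi * of_int m * (real r / real N)))) =
       gauss_sum N a m * exp (- (of_real pi * (of_int m)\<^sup>2 * (1 / (of_nat N ^ 2 * complex_of_real w)))) * (1 / (of_nat N * complex_of_real (sqrt w)))"
      unfolding gauss_sum_def times_divide_eq_right[symmetric] sum_distrib_right by (intro sum.cong refl) (simp only: mult_ac)
  qed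
  also have "\<dots> = (\<Sum>\<^sub>\<infinity>m. gauss_sum N a m * exp (- (of_real pi * (of_int m)\<^sup>2 * (1 / (of_nat N ^ 2 * complex_of_real w))))) * (1 / (of_nat N * complex_of_real (sqrt w)))"
    by (rule infsum_cmult_left')
  finally show ?thesis unfolding f_def by simp
qed

lemma one_islimpt_positive_reals: "1 islimpt (complex_of_real ` {0<..})"
proof -
  have "\<exists>y\<in>complex_of_real ` {0<..}. y \<noteq> 1 \<and> dist y 1 < e" if "e > 0" for e
  proof
    show "complex_of_real (1 + e / 2) \<in> complex_of_real ` {0<..}" using that by (intro imageI) simp
    show "complex_of_real (1 + e / 2) \<noteq> 1 \<and> dist (complex_of_real (1 + e / 2)) 1 < e"
      using that by (auto simp: dist_norm complex_eq_iff norm_divide)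
  qed
  then show ?thesis unfolding islimpt_approachable by blast
qed

lemma eq_on_right_halfplane:
  assumes "f holomorphic_on {w. 0 < Re w}" "g holomorphic_on {w. 0 < Re w}"
    and eq: "\<And>x. 0 < x \<Longrightarrow> f (complex_of_real x) = g (complex_of_real x)" and "0 < Re w"
  shows "f w = g w"
proof -
  have "f w - g w = 0"
  proof (rule analytic_continuation[where f = "\<lambda>z. f z - g z" and S = "{w. 0 < Re w}" and U = "complex_of_real ` {0<..}" and \<xi> = 1])
    show "open {w. 0 < Re w}" by (rule open_halfspace_Re_gt)
    show "connected {w. 0 < Re w}" by (intro convex_connected convex_halfspace_Re_gt)
  qed (use assms one_islimpt_positive_reals in \<open>auto intro!: holomorphic_intros\<close>)
  then show ?thesis by simp
qed

section \<open>Behaviour of the theta primitive at the origin\<close>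

context
  fixes N :: nat and a :: "int \<Rightarrow> complex" and B :: real
  assumes N: "N > 0" and per: "\<And>k. a (k + int N) = a k"
    and a0: "a 0 = 1" and a: "\<And>k. norm (a k) \<le> 1"
    and B: "\<And>m. norm (gauss_sum N a m) \<le> B"
begin

text \<open>The primitive of the theta series with coefficients a that vanishes at 0; the summand w
  is the term k = 0, as a 0 = 1.\<close>

definition phase_primitive :: "complex \<Rightarrow> complex" where
  "phase_primitive w = w + gauss_series a 0 - gauss_series a w"

text \<open>A primitive attached to the transformed theta series. The factor N is chosen so that
  \<open>w * csqrt w\<close> times its derivative is the transformed series without its constant
  term.\<close>

definition dual_series :: "complex \<Rightarrow> complex" where
  "dual_series w = of_nat N * gauss_series (gauss_sum N a) (1 / (of_nat N ^ 2 * w))"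

lemma B0: "B \<ge> 0" using B[of 0] norm_ge_zero order_trans by blast

lemma Re_inverse_pos:
  assumes "0 < Re w"
  shows "0 < Re (1 / (of_nat N ^ 2 * w))"
proof -
  have "1 / (of_nat N ^ 2 * w) = complex_of_real (1 / (real N)\<^sup>2) * inverse w"
    by (simp add: divide_inverse)
  then have "Re (1 / (of_nat N ^ 2 * w)) = 1 / (real N)\<^sup>2 * Re (inverse w)" by simp
  moreover have "Re (inverse w) > 0" using assms by (simp add: divide_pos_pos add_pos_nonneg)
  ultimately show ?thesis using N by (simp only:) (intro mult_pos_pos, auto)
qed

lemma norm_dual_series_le: "0 < Re w \<Longrightarrow> norm (dual_series w) \<le> N * B * inv_square_sum"
  using norm_gauss_series_le[where c = "gauss_sum N a", OF B, of "1 / (of_nat N ^ 2 * w)"] Re_inverse_pos[of w]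
  by (simp add: dual_series_def norm_mult mult.assoc mult_left_mono)

lemma continuous_on_phase_primitive: "continuous_on {w. 0 \<le> Re w} phase_primitive"
  unfolding phase_primitive_def by (intro continuous_intros continuous_on_gauss_series[where c = a, OF a])

lemma phase_primitive_0: "phase_primitive 0 = 0" by (simp add: phase_primitive_def)

lemma has_field_derivative_phase_primitive:
  assumes "0 < Re w"
  shows "(phase_primitive has_field_derivative (\<Sum>\<^sub>\<infinity>k. a k * exp (- (of_real pi * (of_int k)\<^sup>2 * w)))) (at w)"
  unfolding phase_primitive_def
  by (rule derivative_eq_intros has_field_derivative_gauss_series[where c = a, OF a assms] refl)+ (simp add: a0)

lemma has_field_derivative_dual_series:
  assumes w: "0 < Re w"
  shows "(dual_series has_field_derivative
     (((\<Sum>\<^sub>\<infinity>m. gauss_sum N a m * exp (- (of_real pi * (of_int m)\<^sup>2 * (1 / (of_nat N ^ 2 * w))))) - gauss_sum N a 0) / (of_nat N * w\<^sup>2))) (at w)"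
proof -
  have w0: "w \<noteq> 0" using w by auto
  have "((\<lambda>w. 1 / (of_nat N ^ 2 * w)) has_field_derivative - 1 / (of_nat N ^ 2 * w\<^sup>2)) (at w)"
    using w0 N by (auto intro!: derivative_eq_intros simp: field_simps power2_eq_square)
  from DERIV_chain2[OF has_field_derivative_gauss_series[where c = "gauss_sum N a", OF B Re_inverse_pos[OF w]] this]
  have "((\<lambda>w. of_nat N * gauss_series (gauss_sum N a) (1 / (of_nat N ^ 2 * w))) has_field_derivative
    of_nat N * ((gauss_sum N a 0 - (\<Sum>\<^sub>\<infinity>m. gauss_sum N a m * exp (- (of_real pi * (of_int m)\<^sup>2 * (1 / (of_nat N ^ 2 * w)))))) * (- 1 / (of_nat N ^ 2 * w\<^sup>2)))) (at w)"
    by (rule DERIV_cmult)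
  then show ?thesis unfolding dual_series_def[abs_def]
    by (rule DERIV_cong) (use N w0 in \<open>simp add: field_simps power2_eq_square\<close>)
qed

lemma holomorphic_on_phase_primitive: "phase_primitive holomorphic_on {w. 0 < Re w}"
  unfolding phase_primitive_def using holomorphic_on_gauss_series[of a, OF a] by (intro holomorphic_intros)

lemma holomorphic_on_dual_series: "dual_series holomorphic_on {w. 0 < Re w}"
  unfolding holomorphic_on_def field_differentiable_def
  using has_field_derivative_dual_series has_field_derivative_at_within by blast

lemma Re_pos_notin_nonpos: "0 < Re w \<Longrightarrow> w \<notin> \<real>\<^sub>\<le>\<^sub>0"
  by (auto simp: complex_nonpos_Reals_iff)

text \<open>For positive reals this is the theta transformation: the dual term m = 0 gives the
  singular part in w^(-1/2), the other terms give the derivative of \<open>dual_series\<close>. The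
  identity theorem extends it to the half-plane, where the principal root is holomorphic.\<close>

lemma deriv_phase_primitive_eq:
  assumes "0 < Re w"
  shows "deriv phase_primitive w = gauss_sum N a 0 / of_nat N / csqrt w + w * csqrt w * deriv dual_series w"
proof (rule eq_on_right_halfplane[OF _ _ _ assms])
  show "deriv phase_primitive holomorphic_on {w. 0 < Re w}"
    by (intro holomorphic_deriv holomorphic_on_phase_primitive open_halfspace_Re_gt)
  have C: "csqrt holomorphic_on {w. 0 < Re w}"
    by (rule holomorphic_on_subset[OF holomorphic_on_csqrt]) (auto simp: Re_pos_notin_nonpos)
  have "deriv dual_series holomorphic_on {w. 0 < Re w}"
    by (intro holomorphic_deriv holomorphic_on_dual_series open_halfspace_Re_gt)
  then show "(\<lambda>w. gauss_sum N a 0 / of_nat N / csqrt w + w * csqrt w * deriv dual_series w) holomorphic_on {w. 0 < Re w}"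
    using N by (intro holomorphic_on_add holomorphic_on_mult holomorphic_on_divide C holomorphic_on_const holomorphic_on_ident) auto
  fix x :: real assume x: "0 < x"
  have sq: "complex_of_real (sqrt x) * complex_of_real (sqrt x) = of_real x"
    using x real_sqrt_mult_self[of x] by (metis of_real_mult abs_of_pos)
  define T where "T = (\<Sum>\<^sub>\<infinity>m. gauss_sum N a m * exp (- (of_real pi * (of_int m)\<^sup>2 * (1 / (of_nat N ^ 2 * complex_of_real x)))))"
  have "deriv phase_primitive (of_real x) = T / (of_nat N * complex_of_real (sqrt x))"
    unfolding T_def theta_transformation[where a = a, OF N per a x, symmetric]
    by (intro DERIV_imp_deriv has_field_derivative_phase_primitive) (use x in simp)
  moreover have "deriv dual_series (of_real x) = (T - gauss_sum N a 0) / (of_nat N * (of_real x)\<^sup>2)"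
    unfolding T_def by (intro DERIV_imp_deriv has_field_derivative_dual_series) (use x in simp)
  moreover have "csqrt (of_real x) = of_real (sqrt x)" using x by (simp add: csqrt_of_real_nonneg)
  moreover have "of_real x * complex_of_real (sqrt x) * ((T - gauss_sum N a 0) / (of_nat N * (of_real x)\<^sup>2))
      = (T - gauss_sum N a 0) / (of_nat N * complex_of_real (sqrt x))"
    using x N by (simp add: field_simps power2_eq_square sq)
  ultimately show "deriv phase_primitive (of_real x) = gauss_sum N a 0 / of_nat N / csqrt (of_real x) + of_real x * csqrt (of_real x) * deriv dual_series (of_real x)"
    by (simp add: diff_divide_distrib)
qed

text \<open>What integration by parts leaves: the primitive of the singular part and the boundary
  term \<open>w * csqrt w * dual_series w\<close> are subtracted, so the derivative contains only
  the bounded \<open>dual_series\<close> itself and not its derivative.\<close>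

definition remainder :: "complex \<Rightarrow> complex" where
  "remainder w = phase_primitive w - 2 * gauss_sum N a 0 / of_nat N * csqrt w - w * csqrt w * dual_series w"

lemma has_field_derivative_remainder:
  assumes w: "0 < Re w"
  shows "(remainder has_field_derivative - (3/2 * csqrt w * dual_series w)) (at w)"
proof -
  have w0: "csqrt w \<noteq> 0" using w by auto
  have sq: "w = csqrt w * csqrt w" by (simp flip: power2_eq_square)
  have P: "(phase_primitive has_field_derivative deriv phase_primitive w) (at w)"
    using has_field_derivative_phase_primitive[OF w] DERIV_imp_deriv[OF has_field_derivative_phase_primitive[OF w]] by simp
  have E: "(dual_series has_field_derivative deriv dual_series w) (at w)"
    using has_field_derivative_dual_series[OF w] DERIV_imp_deriv[OF has_field_derivative_dual_series[OF w]] by simp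
  have C: "(csqrt has_field_derivative inverse (2 * csqrt w)) (at w)"
    using w by (intro has_field_derivative_csqrt Re_pos_notin_nonpos)
  have "(remainder has_field_derivative deriv phase_primitive w - 2 * gauss_sum N a 0 / of_nat N * inverse (2 * csqrt w)
      - ((1 * csqrt w + inverse (2 * csqrt w) * w) * dual_series w + deriv dual_series w * (w * csqrt w))) (at w)"
    unfolding remainder_def[abs_def]
    by (intro DERIV_diff P DERIV_cmult C DERIV_mult E DERIV_ident)
  moreover have "inverse (2 * csqrt w) * w = csqrt w / 2"
    using w0 by (subst (2) sq) (simp add: field_simps)
  ultimately have "(remainder has_field_derivative deriv phase_primitive w - 2 * gauss_sum N a 0 / of_nat N * inverse (2 * csqrt w)
      - ((1 * csqrt w + csqrt w / 2) * dual_series w + deriv dual_series w * (w * csqrt w))) (at w)" by simp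
  then show ?thesis
    by (rule DERIV_cong) (use w0 N in \<open>simp add: deriv_phase_primitive_eq[OF w] field_simps\<close>)
qed

text \<open>The derivative is at most C on the convex half-disc H, so the mean value inequality
  applies between s w and w. Letting s tend to 0 finishes, since the remainder tends to 0 along the
  ray.\<close>

lemma norm_remainder_le:
  assumes w: "0 < Re w"
  shows "norm (remainder w) \<le> 3/2 * (N * B * inv_square_sum) * norm w * sqrt (norm w)"
proof -
  define C where "C = 3/2 * (N * B * inv_square_sum) * sqrt (norm w)"
  define H where "H = {z. 0 < Re z} \<inter> cball 0 (norm w)"
  have step: "norm (remainder w - remainder (of_real s * w)) \<le> C * norm w" if s: "0 < s" "s < 1" for s :: real
  proof -
    have "norm (remainder w - remainder (of_real s * w)) \<le> C * norm (w - of_real s * w)"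
    proof (rule field_differentiable_bound[where S = H])
      show "convex H" unfolding H_def by (intro convex_Int convex_halfspace_Re_gt convex_cball)
      fix z assume z: "z \<in> H"
      then have "(remainder has_field_derivative - (3/2 * csqrt z * dual_series z)) (at z)"
        by (intro has_field_derivative_remainder) (auto simp: H_def)
      then show "(remainder has_field_derivative - (3/2 * csqrt z * dual_series z)) (at z within H)"
        by (rule has_field_derivative_at_within)
      have "sqrt (norm z) * norm (dual_series z) \<le> sqrt (norm w) * (N * B * inv_square_sum)"
        using z by (intro mult_mono norm_dual_series_le) (auto simp: H_def)
      then show "norm (- (3/2 * csqrt z * dual_series z)) \<le> C" by (simp add: C_def norm_mult mult_ac)
    next
      show "w \<in> H" "of_real s * w \<in> H" using w s by (auto simp: H_def norm_mult mult_left_le_one_le)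
    qed
    also have "\<dots> \<le> C * norm w"
    proof (rule mult_left_mono)
      show "norm (w - of_real s * w) \<le> norm w"
      proof -
        have "w - of_real s * w = of_real (1 - s) * w" by (simp add: algebra_simps)
        also have "norm \<dots> \<le> 1 * norm w" unfolding norm_mult norm_of_real using s by (intro mult_right_mono) auto
        finally show ?thesis by simp
      qed
      show "C \<ge> 0" using B0 inv_square_sum_pos unfolding C_def by simp
    qed
    finally show ?thesis .
  qed
  have "((\<lambda>s. remainder (of_real s * w)) \<longlongrightarrow> 0) (at_right 0)"
  proof -
    have "((\<lambda>s. of_real s * w) \<longlongrightarrow> 0) (at_right 0)"
      by (auto intro!: tendsto_eq_intros)
    moreover have "\<forall>\<^sub>F s in at_right 0. of_real s * w \<in> {w. 0 \<le> Re w}"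
      unfolding eventually_at_right_field using w by (intro exI[of _ 1]) auto
    ultimately have "((\<lambda>s. phase_primitive (of_real s * w)) \<longlongrightarrow> phase_primitive 0) (at_right 0)"
      by (intro continuous_on_tendsto_compose[OF continuous_on_phase_primitive]) auto
    moreover have "((\<lambda>s. 2 * gauss_sum N a 0 / of_nat N * csqrt (of_real s * w)) \<longlongrightarrow> 0) (at_right 0)"
    proof (rule tendsto_mult_right_zero, rule tendsto_norm_zero_cancel)
      have "((\<lambda>s. sqrt (\<bar>s\<bar> * norm w)) \<longlongrightarrow> sqrt (\<bar>0\<bar> * norm w)) (at_right 0)" by (intro tendsto_intros)
      then show "((\<lambda>s. norm (csqrt (of_real s * w))) \<longlongrightarrow> 0) (at_right 0)" by (simp add: norm_mult)
    qed
    \<comment> \<open>The argument of \<open>dual_series\<close> goes to infinity as s tends to 0,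
      so the uniform bound replaces continuity.\<close>
    moreover have "((\<lambda>s. of_real s * w * csqrt (of_real s * w) * dual_series (of_real s * w)) \<longlongrightarrow> 0) (at_right 0)"
    proof (rule Lim_null_comparison)
      show "\<forall>\<^sub>F s in at_right 0. norm (of_real s * w * csqrt (of_real s * w) * dual_series (of_real s * w)) \<le> 
         norm (of_real s * w) * sqrt (norm (of_real s * w)) * (N * B * inv_square_sum)"
        unfolding eventually_at_right_field
      proof (intro exI[of _ 1] conjI allI impI)
        fix s :: real assume "s > 0"
        then have "norm (dual_series (of_real s * w)) \<le> N * B * inv_square_sum" using w by (intro norm_dual_series_le) simp
        then show "norm (of_real s * w * csqrt (of_real s * w) * dual_series (of_real s * w)) \<le> 
         norm (of_real s * w) * sqrt (norm (of_real s * w)) * (N * B * inv_square_sum)"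
          by (simp only: norm_mult norm_csqrt) (intro mult_left_mono, auto)
      qed auto
      show "((\<lambda>s. norm (of_real s * w) * sqrt (norm (of_real s * w)) * (N * B * inv_square_sum)) \<longlongrightarrow> 0) (at_right 0)"
      proof -
        have "((\<lambda>s. \<bar>s\<bar> * norm w * sqrt (\<bar>s\<bar> * norm w) * (N * B * inv_square_sum)) \<longlongrightarrow>
           \<bar>0\<bar> * norm w * sqrt (\<bar>0\<bar> * norm w) * (N * B * inv_square_sum)) (at_right 0)" by (intro tendsto_intros)
        then show ?thesis by (simp add: norm_mult)
      qed
    qed
    ultimately have "((\<lambda>s. remainder (of_real s * w)) \<longlongrightarrow> phase_primitive 0 - 0 - 0) (at_right 0)"
      unfolding remainder_def by (intro tendsto_diff)
    then show ?thesis by (simp add: phase_primitive_0)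
  qed
  then have "((\<lambda>s. norm (remainder w - remainder (of_real s * w))) \<longlongrightarrow> norm (remainder w - 0)) (at_right 0)"
    by (intro tendsto_intros)
  moreover have "\<forall>\<^sub>F s in at_right 0. norm (remainder w - remainder (of_real s * w)) \<le> C * norm w"
    unfolding eventually_at_right_field using step by (intro exI[of _ 1]) auto
  ultimately have "norm (remainder w - 0) \<le> C * norm w"
    by (rule tendsto_upperbound) simp
  then show ?thesis by (simp add: C_def mult_ac)
qed

text \<open>The constant is 3/2 from the remainder plus 1 from the boundary term.\<close>

lemma phase_primitive_asymptotics_open:
  assumes w: "0 < Re w"
  shows "norm (phase_primitive w - 2 * gauss_sum N a 0 / of_nat N * csqrt w) \<le> 5/2 * (N * B * inv_square_sum) * norm w * sqrt (norm w)"
proof -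
  have "phase_primitive w - 2 * gauss_sum N a 0 / of_nat N * csqrt w = remainder w + w * csqrt w * dual_series w" by (simp add: remainder_def)
  also have "norm \<dots> \<le> norm (remainder w) + norm (w * csqrt w * dual_series w)" by (rule norm_triangle_ineq)
  also have "norm (w * csqrt w * dual_series w) \<le> norm w * sqrt (norm w) * (N * B * inv_square_sum)"
    using norm_dual_series_le[OF w] by (simp add: norm_mult mult_left_mono)
  finally show ?thesis using norm_remainder_le[OF w] by (simp add: algebra_simps)
qed

text \<open>Shifting w by a small positive real and passing to the limit reaches the imaginary axis,
  where the curve lives. A nonzero w with nonnegative real part avoids the branch cut of
  \<open>csqrt\<close>.\<close>

lemma phase_primitive_asymptotics:
  assumes w: "0 \<le> Re w" "w \<noteq> 0"
  shows "norm (w + gauss_series a 0 - gauss_series a w - 2 * gauss_sum N a 0 / of_nat N * csqrt w)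
     \<le> 5/2 * (N * B * inv_square_sum) * norm w * sqrt (norm w)"
proof -
  have "((\<lambda>e. w + of_real e) \<longlongrightarrow> w) (at_right 0)"
    by (auto intro!: tendsto_eq_intros)
  moreover have ev: "\<forall>\<^sub>F e in at_right 0. 0 < Re (w + of_real e)"
    unfolding eventually_at_right_field using w by (intro exI[of _ 1]) auto
  moreover have "w \<notin> \<real>\<^sub>\<le>\<^sub>0" using w by (auto simp: complex_nonpos_Reals_iff complex_eq_iff)
  ultimately have "((\<lambda>e. phase_primitive (w + of_real e)) \<longlongrightarrow> phase_primitive w) (at_right 0)" 
    "((\<lambda>e. csqrt (w + of_real e)) \<longlongrightarrow> csqrt w) (at_right 0)" "((\<lambda>e. w + of_real e) \<longlongrightarrow> w) (at_right 0)"
    using w by (auto intro!: continuous_on_tendsto_compose[OF continuous_on_phase_primitive] isCont_tendsto_compose[OF continuous_at_csqrt]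
        elim: eventually_mono)
  then have "norm (phase_primitive w - 2 * gauss_sum N a 0 / of_nat N * csqrt w) \<le> 5/2 * (N * B * inv_square_sum) * norm w * sqrt (norm w)"
    by (intro tendsto_le[OF _ _ _ eventually_mono[OF ev phase_primitive_asymptotics_open]]) (use N in \<open>auto intro!: tendsto_intros\<close>)
  then show ?thesis by (simp add: phase_primitive_def)
qed

end

section \<open>Quadratic phases and Gauss sums\<close>

definition quad_phase :: "real \<Rightarrow> int \<Rightarrow> complex" where
  "quad_phase X k = cis (pi * (of_int k)\<^sup>2 * X)"

text \<open>Normalised so that the increments over \<open>H\<close> are values of a theta primitive at \<open>- \<i> H\<close> with
  the phases \<open>quad_phase X\<close>.\<close>

definition curve :: "real \<Rightarrow> complex" where
  "curve X = 4 * of_real pi * riemann_phi (- X / (4 * pi))"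

lemma summable_gauss_terms:
  assumes "\<And>k. norm (c k) \<le> B" "0 \<le> Re w"
  shows "(\<lambda>k. c k * exp (- (of_real pi * (of_int k)\<^sup>2 * w)) / (of_real pi * (of_int k)\<^sup>2)) summable_on UNIV"
  by (rule summable_on_norm_le[OF summable_inv_square[of B]]) (rule norm_gauss_term_le[where c = c, OF assms])

text \<open>With w = 4 pi i x the exponent becomes pi k^2 w. The linear term k = 0 stands apart
  because \<open>gauss_series\<close> drops it.\<close>

lemma riemann_phi_eq:
  "riemann_phi x = \<i> * of_real x +
     (gauss_series (\<lambda>_. 1) 0 - gauss_series (\<lambda>_. 1) (4 * of_real pi * \<i> * of_real x)) / (4 * of_real pi)"
proof -
  define w where "w = 4 * of_real pi * \<i> * complex_of_real x"
  have w: "0 \<le> Re w" by (simp add: w_def)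
  define g where "g z k = 1 * exp (- (of_real pi * (of_int k)\<^sup>2 * z)) / (of_real pi * (of_int k)\<^sup>2)" for z :: complex and k :: int
  have hs: "(g z has_sum gauss_series (\<lambda>_. 1) z) UNIV" if "0 \<le> Re z" for z
    unfolding g_def gauss_series_def by (intro has_sum_infsum summable_gauss_terms[where B = 1] that) auto
  have "((\<lambda>k. (g 0 k + - g w k) * (1 / (4 * of_real pi))) has_sum
      ((gauss_series (\<lambda>_. 1) 0 + - gauss_series (\<lambda>_. 1) w) * (1 / (4 * of_real pi)))) UNIV"
    by (intro has_sum_cmult_left has_sum_add has_sum_uminusI hs w) simp
  moreover have "((\<lambda>k::int. if k = 0 then \<i> * of_real x else 0) has_sum \<i> * of_real x) UNIV"
    by (rule has_sum_finite_neutralI[of "{0}"]) auto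
  ultimately have "((\<lambda>k. (if k = 0 then \<i> * of_real x else 0) + (g 0 k + - g w k) * (1 / (4 * of_real pi))) has_sum
      (\<i> * of_real x + (gauss_series (\<lambda>_. 1) 0 + - gauss_series (\<lambda>_. 1) w) * (1 / (4 * of_real pi)))) UNIV"
    by (intro has_sum_add)
  moreover have "(if k = 0 then \<i> * of_real x else 0) + (g 0 k + - g w k) * (1 / (4 * of_real pi)) =
     (if k = 0 then \<i> * of_real x
        else (exp (- 4 * of_real pi ^ 2 * \<i> * of_int k ^ 2 * of_real x) - 1) / (- 4 * of_real pi ^ 2 * of_int k ^ 2))" for k
  proof (cases "k = 0")
    case False
    have "- (of_real pi * (of_int k)\<^sup>2 * w) = - 4 * of_real pi ^ 2 * \<i> * of_int k ^ 2 * of_real x"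
      by (simp add: w_def power2_eq_square)
    then show ?thesis using False by (simp add: g_def field_simps power2_eq_square)
  qed (simp add: g_def)
  ultimately show ?thesis unfolding riemann_phi_def w_def by (simp add: infsumI)
qed

lemma norm_quad_phase: "norm (quad_phase X k) \<le> 1" by (simp add: quad_phase_def)

lemma quad_phase_0: "quad_phase X 0 = 1" by (simp add: quad_phase_def)

lemma curve_eq: "curve X = - \<i> * of_real X + gauss_series (\<lambda>_. 1) 0 - gauss_series (\<lambda>_. 1) (- \<i> * of_real X)"
proof -
  have "4 * of_real pi * \<i> * of_real (- X / (4 * pi)) = - \<i> * of_real X" by simp
  then show ?thesis unfolding curve_def riemann_phi_eq by (simp add: field_simps)
qed

text \<open>The exponential factors, so a shift by X becomes the unimodular coefficient
  \<open>quad_phase X k\<close>; the local behaviour at X is that of a theta primitive at the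
  origin.\<close>

lemma curve_add:
  "curve (X + H) - curve X = - \<i> * of_real H + gauss_series (quad_phase X) 0 - gauss_series (quad_phase X) (- \<i> * of_real H)"
proof -
  have "1 * exp (- (of_real pi * (of_int k)\<^sup>2 * (- \<i> * of_real (X + H)))) = quad_phase X k * exp (- (of_real pi * (of_int k)\<^sup>2 * (- \<i> * of_real H)))" for k H
  proof -
    have "quad_phase X k = exp (- (of_real pi * (of_int k)\<^sup>2 * (- \<i> * of_real X)))"
      by (simp add: quad_phase_def cis_conv_exp mult_ac)
    then show ?thesis by (simp add: algebra_simps flip: exp_add)
  qed
  then have "gauss_series (\<lambda>_. 1) (- \<i> * of_real (X + H)) = gauss_series (quad_phase X) (- \<i> * of_real H)" for H
    unfolding gauss_series_def by simp
  from this[of H] this[of 0] show ?thesis unfolding curve_eq by (simp add: algebra_simps)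
qed

lemma continuous_on_riemann_phi: "continuous_on UNIV riemann_phi"
proof -
  have "continuous_on UNIV (\<lambda>x. gauss_series (\<lambda>_. 1) (4 * of_real pi * \<i> * of_real x))"
    by (rule continuous_on_compose2[OF continuous_on_gauss_series[where c = "\<lambda>_. 1" and B = 1]])
       (auto intro!: continuous_intros)
  then show ?thesis unfolding riemann_phi_eq[abs_def] by (intro continuous_intros) auto
qed

section \<open>Periodicity of quadratic phases and the modulus of Gauss sums\<close>

lemma cis_2pi_of_int: "cis (2 * pi * of_int n) = 1"
  by (rule cis_multiple_2pi) simp

lemma cis_pi_even: "even n \<Longrightarrow> cis (pi * of_int n) = 1"
  by (elim evenE) (use cis_2pi_of_int in \<open>simp add: mult_ac\<close>)

lemma cis_pi_odd: "odd n \<Longrightarrow> cis (pi * of_int n) = - 1"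
proof (elim oddE)
  fix m assume "n = 2 * m + 1"
  then have "pi * of_int n = 2 * pi * of_int m + pi" by (simp add: algebra_simps)
  then show ?thesis by (simp add: cis_2pi_of_int flip: cis_mult)
qed

text \<open>The cross term is a multiple of 2 pi, leaving the sign (-1)^(n^2 p q). Hence q is a
  period when p q is even, the phase changes sign under q when p q is odd, and 2q is always a
  period.\<close>

lemma quad_phase_shift:
  assumes "q > 0"
  shows "quad_phase (of_int p / of_nat q) (k + int q * n) = quad_phase (of_int p / of_nat q) k * cis (pi * of_int (n * n * p * int q))"
proof -
  have "pi * (of_int (k + int q * n))\<^sup>2 * (of_int p / of_nat q) =
     pi * (of_int k)\<^sup>2 * (of_int p / of_nat q) + (2 * pi * of_int (k * n * p) + pi * of_int (n * n * p * int q))"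
    using assms by (simp add: field_simps power2_eq_square)
  then show ?thesis unfolding quad_phase_def by (simp only: cis_mult[symmetric] cis_2pi_of_int mult_1_left)
qed

lemma sum_periodic_shift:
  fixes F :: "int \<Rightarrow> complex"
  assumes "\<And>k. F (k + int q) = F k"
  shows "(\<Sum>d<q. F (int s + int d)) = (\<Sum>d<q. F (int d))"
proof (induction s)
  case (Suc s)
  have "(\<Sum>d<q. F (int s + int (Suc d))) + F (int s + int 0) = (\<Sum>d<Suc q. F (int s + int d))"
    by (subst sum.lessThan_Suc_shift) simp
  also have "\<dots> = (\<Sum>d<q. F (int s + int d)) + F (int s)" using assms[of "int s"] by simp
  finally show ?case using Suc by (simp add: algebra_simps)
qed simp

lemma sum_roots_of_unity:
  assumes "q > 0" "coprime p (int q)" "d < q"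
  shows "(\<Sum>s<q. cis (2 * pi * of_int (p * int s * int d) / of_nat q)) = (if d = 0 then of_nat q else 0)"
proof (cases "d = 0")
  case False
  define z where "z = cis (2 * pi * of_int (p * int d) / of_nat q)"
  have pw: "z ^ s = cis (2 * pi * of_int (p * int s * int d) / of_nat q)" for s
    unfolding z_def Complex.DeMoivre by (simp add: mult_ac)
  have zq: "z ^ q = 1"
  proof -
    have "2 * pi * of_int (p * int q * int d) / of_nat q = 2 * pi * of_int (p * int d)" using assms by simp
    then show ?thesis unfolding pw by (simp only: cis_2pi_of_int)
  qed
  have "z \<noteq> 1"
  proof
    assume "z = 1"
    then have "exp (\<i> * of_real (2 * pi * of_int (p * int d) / of_nat q)) = 1" by (simp add: z_def cis_conv_exp)
    then obtain n :: int where "2 * pi * of_int (p * int d) / of_nat q = of_int (2 * n) * pi"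
      unfolding exp_eq_1 by auto
    then have "of_int (p * int d) = (of_int (n * int q) :: real)" using assms(1) by (simp add: field_simps)
    then have "p * int d = n * int q" by (simp only: of_int_eq_iff)
    then have "int q dvd p * int d" by simp
    then have "int q dvd int d" using assms(2) by (simp add: coprime_commute coprime_dvd_mult_right_iff)
    then show False using False assms(3) by (simp add: dvd_imp_le nat_dvd_not_less)
  qed
  then have "(\<Sum>s<q. z ^ s) = 0" by (simp add: geometric_sum zq)
  then show ?thesis using False unfolding pw by simp
qed simp

text \<open>Expand G times its conjugate and use periodicity to sum over the difference d of the two
  indices. The terms quadratic in s cancel, and the remaining linear phase sums over s to 0 unless d
  = 0.\<close>

lemma norm_gauss_sum_quad_phase:
  assumes q: "q > 0" and cop: "coprime p (int q)" and ev: "even (p * int q)"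
  shows "norm (gauss_sum q (quad_phase (of_int p / of_nat q)) m) = sqrt q"
proof -
  define F where "F k = quad_phase (of_int p / of_nat q) k * cis (2 * pi * of_int m * of_int k / of_nat q)" for k
  define G where "G = (\<Sum>r<q. F (int r))"
  have G: "gauss_sum q (quad_phase (of_int p / of_nat q)) m = G" by (simp add: gauss_sum_def G_def F_def)
  have per: "F (k + int q) = F k" for k
  proof -
    have "2 * pi * of_int m * of_int (k + int q) / of_nat q = 2 * pi * of_int m * of_int k / of_nat q + 2 * pi * of_int m"
      using q by (simp add: field_simps)
    then have "cis (2 * pi * of_int m * of_int (k + int q) / of_nat q) = cis (2 * pi * of_int m * of_int k / of_nat q)"
      by (simp only: cis_mult[symmetric] cis_2pi_of_int mult_1_right)
    moreover have "quad_phase (of_int p / of_nat q) (k + int q) = quad_phase (of_int p / of_nat q) k"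
      using quad_phase_shift[OF q, of p k 1] ev by (simp only: mult_1_left mult_1_right cis_pi_even)
    ultimately show ?thesis by (simp add: F_def)
  qed
  have shift: "F (int s + int d) * cnj (F (int s)) = F (int d) * cis (2 * pi * of_int (p * int s * int d) / of_nat q)" for s d
  proof -
    have "pi * (real_of_int (int s + int d))\<^sup>2 * (of_int p / of_nat q) + 2 * pi * of_int m * of_int (int s + int d) / of_nat q
         - (pi * (real_of_int (int s))\<^sup>2 * (of_int p / of_nat q) + 2 * pi * of_int m * of_int (int s) / of_nat q)
         = pi * (real_of_int (int d))\<^sup>2 * (of_int p / of_nat q) + 2 * pi * of_int m * of_int (int d) / of_nat q
           + 2 * pi * of_int (p * int s * int d) / of_nat q"
      using q by (simp add: field_simps power2_eq_square)
    then show ?thesis unfolding F_def quad_phase_def cis_mult cis_cnj by (metis uminus_add_conv_diff add.commute)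
  qed
  have "G * cnj G = (\<Sum>s<q. G * cnj (F (int s)))" by (simp add: G_def sum_distrib_left)
  also have "\<dots> = (\<Sum>s<q. \<Sum>d<q. F (int d) * cis (2 * pi * of_int (p * int s * int d) / of_nat q))"
  proof (intro sum.cong refl)
    fix s
    have "G = (\<Sum>d<q. F (int s + int d))" unfolding G_def by (rule sum_periodic_shift[where F = F, OF per, symmetric])
    then show "G * cnj (F (int s)) = (\<Sum>d<q. F (int d) * cis (2 * pi * of_int (p * int s * int d) / of_nat q))"
      by (simp only: sum_distrib_right shift)
  qed
  also have "\<dots> = (\<Sum>d<q. F (int d) * (\<Sum>s<q. cis (2 * pi * of_int (p * int s * int d) / of_nat q)))"
    by (subst sum.swap) (simp only: sum_distrib_left)
  also have "\<dots> = (\<Sum>d<q. if d = 0 then F 0 * of_nat q else 0)"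
  proof (intro sum.cong refl)
    fix d assume "d \<in> {..<q}"
    then have "(\<Sum>s<q. cis (2 * pi * of_int (p * int s * int d) / of_nat q)) = (if d = 0 then of_nat q else 0)"
      by (intro sum_roots_of_unity q cop) simp
    then show "F (int d) * (\<Sum>s<q. cis (2 * pi * of_int (p * int s * int d) / of_nat q)) = (if d = 0 then F 0 * of_nat q else 0)"
      by (simp only:) simp
  qed
  also have "\<dots> = of_nat q" using q by (simp add: F_def quad_phase_0)
  finally have "complex_of_real ((norm G)\<^sup>2) = complex_of_real (real q)"
    by (simp only: complex_norm_square of_real_of_nat_eq)
  then have "(norm G)\<^sup>2 = real q" by (simp only: of_real_eq_iff)
  then show ?thesis unfolding G by (metis norm_ge_zero real_sqrt_unique)
qed

text \<open>The two roots differ by a quarter turn: this is the source of the right angle.\<close>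

lemma csqrt_imaginary:
  assumes "H > 0"
  shows "csqrt (- \<i> * of_real H) = of_real (sqrt H) * cis (- pi / 4)"
    and "csqrt (\<i> * of_real H) = of_real (sqrt H) * cis (pi / 4)"
proof -
  have sq: "(complex_of_real (sqrt H))\<^sup>2 = of_real H" using assms by (simp flip: of_real_power)
  have "(of_real (sqrt H) * cis (- pi / 4))\<^sup>2 = - \<i> * of_real H"
    unfolding power_mult_distrib sq Complex.DeMoivre by (simp add: complex_eq_iff)
  then show "csqrt (- \<i> * of_real H) = of_real (sqrt H) * cis (- pi / 4)"
    using assms by (intro csqrt_unique) (auto simp: cos_45)
  have "(of_real (sqrt H) * cis (pi / 4))\<^sup>2 = \<i> * of_real H"
    unfolding power_mult_distrib sq Complex.DeMoivre by (simp add: complex_eq_iff)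
  then show "csqrt (\<i> * of_real H) = of_real (sqrt H) * cis (pi / 4)"
    using assms by (intro csqrt_unique) (auto simp: cos_45)
qed

definition good_fraction :: "int \<Rightarrow> nat \<Rightarrow> bool" where
  "good_fraction p q \<longleftrightarrow> q > 0 \<and> coprime p (int q) \<and> even (p * int q)"

lemma curve_near_good:
  assumes g: "good_fraction p q" and H: "H \<noteq> 0"
  shows "norm (curve (of_int p / of_nat q + H) - curve (of_int p / of_nat q)
      - 2 * gauss_sum q (quad_phase (of_int p / of_nat q)) 0 / of_nat q * csqrt (- \<i> * of_real H))
    \<le> 5/2 * inv_square_sum * (real q * sqrt q) * (\<bar>H\<bar> * sqrt \<bar>H\<bar>)"
proof -
  have q: "q > 0" using g by (simp add: good_fraction_def)
  have per: "quad_phase (of_int p / of_nat q) (k + int q) = quad_phase (of_int p / of_nat q) k" for k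
    using quad_phase_shift[OF q, of p k 1] g unfolding good_fraction_def by (simp only: mult_1_left mult_1_right cis_pi_even)
  have B: "norm (gauss_sum q (quad_phase (of_int p / of_nat q)) m) \<le> sqrt q" for m
    using norm_gauss_sum_quad_phase[of q p m] g by (simp add: good_fraction_def)
  show ?thesis unfolding curve_add
    using phase_primitive_asymptotics[where a = "quad_phase (of_int p / of_nat q)" and w = "- \<i> * of_real H", OF q per quad_phase_0 norm_quad_phase B] H
    by (simp add: norm_mult mult_ac)
qed

text \<open>The phase changes sign under a shift by q, so over the period 2q the two halves of the
  Gauss sum cancel and the square root term disappears. Taking N = 2q and the trivial bound B = 2q
  gives the constant 5/2 * 4 = 10.\<close>

lemma curve_near_bad:
  assumes q: "q > 0" and odd: "odd (p * int q)"
  shows "norm (curve (of_int p / of_nat q + H) - curve (of_int p / of_nat q)) \<le> 10 * inv_square_sum * (real q)\<^sup>2 * (\<bar>H\<bar> * sqrt \<bar>H\<bar>)"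
proof (cases "H = 0")
  case False
  let ?a = "quad_phase (of_int p / of_nat q)"
  have "even (2 * 2 * p * int q)" unfolding even_mult_iff by simp
  then have per: "?a (k + int (2 * q)) = ?a k" for k
    using quad_phase_shift[OF q, of p k 2] cis_pi_even[of "2 * 2 * p * int q"] by (simp add: mult_ac)
  have anti: "?a (int (q + r)) = - ?a (int r)" for r
    using quad_phase_shift[OF q, of p "int r" 1] cis_pi_odd[OF odd] by (simp add: add.commute)
  have B: "norm (gauss_sum (2 * q) ?a m) \<le> 2 * real q" for m
  proof -
    have "norm (gauss_sum (2 * q) ?a m) \<le> (\<Sum>r<2*q. 1)"
      unfolding gauss_sum_def by (intro sum_norm_le) (simp add: norm_mult quad_phase_def)
    then show ?thesis by simp
  qed
  have "(\<Sum>r<q + n. ?a (int r)) = (\<Sum>r<q. ?a (int r)) + (\<Sum>r<n. ?a (int (q + r)))" for n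
    by (induction n) auto
  then have "(\<Sum>r<q + q. ?a (int r)) = (\<Sum>r<q. ?a (int r)) + (\<Sum>r<q. - ?a (int r))"
    by (simp only: anti)
  then have "(\<Sum>r<2 * q. ?a (int r)) = 0" by (simp only: sum_negf mult_2) simp
  then have G0: "gauss_sum (2 * q) ?a 0 = 0" by (simp add: gauss_sum_def)
  show ?thesis unfolding curve_add
    using phase_primitive_asymptotics[where N = "2 * q" and a = ?a and w = "- \<i> * of_real H", OF _ per quad_phase_0 norm_quad_phase B] False q
    unfolding G0 by (simp add: norm_mult power2_eq_square mult_ac)
qed simp

section \<open>Corners of the curve\<close>

lemma fraction_neighbour:
  assumes "coprime h k" "k > 0" "n > 0"
  shows "\<exists>p q :: int. k * n \<le> q \<and> q < k * (n + 1) \<and> p * k - h * q = 1"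
proof -
  obtain x y where xy: "h * x + k * y = 1"
    using assms(1) bezout_int[of h k] by (metis coprime_imp_gcd_eq_1 mult.commute)
  \<comment> \<open>Since h x is 1 modulo k, any q congruent to -x makes 1 + h q divisible by k;
    this one is the representative in the required window.\<close>
  define q where "q = k * n + (- x) mod k"
  define z where "z = (- x) div k"
  have "q = k * n + (- x - k * z)" unfolding q_def z_def by (simp add: minus_mult_div_eq_mod)
  then have "1 + h * q = (h * x + k * y) + h * (k * n + (- x - k * z))" using xy by simp
  then have "1 + h * q = k * (y + h * n - h * z)" by (simp add: algebra_simps)
  moreover have "k * n \<le> q" "q < k * (n + 1)" using assms(2) by (auto simp: q_def algebra_simps)
  ultimately show ?thesis by (intro exI[of _ "y + h * n - h * z"] exI[of _ q]) (simp add: algebra_simps)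
qed

text \<open>A common divisor of p and q divides 1; and if both were odd, p k - h q would be
  even.\<close>

lemma good_fraction_neighbour:
  assumes "odd h" "odd k" "p * k - h * q = 1" "q > 0"
  shows "good_fraction p (nat q)"
proof -
  have "coprime p q"
    by (rule coprimeI) (metis assms(3) dvd_diff dvd_mult dvd_mult2)
  moreover have "even (p * q)"
  proof (rule ccontr)
    assume "odd (p * q)"
    then have "even (p * k - h * q)" using assms(1,2) by simp
    then show False using assms(3) by simp
  qed
  ultimately show ?thesis using assms(4) by (simp add: good_fraction_def)
qed

text \<open>Dirichlet approximation gives infinitely many reduced h/k within 1/k^2. If h k is odd, a
  neighbour p/q with k <= q < 2k replaces it, and 6 = 4 + 2 collects 1/k^2 <= 4/q^2 and 1/(kq) <=
  2/q^2.\<close>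

lemma good_approximations:
  assumes X: "X \<notin> \<rat>"
  shows "\<exists>p q. good_fraction p q \<and> M < q \<and> \<bar>X - of_int p / of_nat q\<bar> \<le> 6 / (real q)\<^sup>2"
proof -
  obtain h k where hk: "(h, k) \<in> approx_set X" "int M < k"
    using infinite_approx_set[of X "int M"] rational_iff_finite_approx_set[of X] X by blast
  then have k: "k > 0" and cop: "coprime h k" and near: "\<bar>X - of_int h / of_int k\<bar> < 1 / (of_int k)\<^sup>2"
    by (auto simp: approx_set_def)
  show ?thesis
  proof (cases "even (h * k)")
    case True
    have "1 / (real_of_int k)\<^sup>2 \<le> 6 / (real_of_int k)\<^sup>2" by (intro divide_right_mono) auto
    then have "\<bar>X - of_int h / of_nat (nat k)\<bar> \<le> 6 / (real (nat k))\<^sup>2" using near k by simp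
    moreover have "good_fraction h (nat k)" using True k cop by (simp add: good_fraction_def)
    ultimately show ?thesis using hk(2) k by (intro exI[of _ h] exI[of _ "nat k"]) auto
  next
    case False
    then have odd: "odd h" "odd k" by auto
    obtain p q where pq: "k \<le> q" "q < 2 * k" "p * k - h * q = 1"
      using fraction_neighbour[OF cop k, of 1] by auto
    then have q: "q > 0" using k by simp
    have "real_of_int p * of_int k - of_int h * of_int q = 1"
      using pq(3) by (metis of_int_1 of_int_diff of_int_mult)
    then have "of_int p / of_int q - of_int h / of_int k = 1 / (real_of_int k * of_int q)"
      using k q by (simp add: field_simps)
    then have "\<bar>X - of_int p / of_int q\<bar> \<le> 1 / (of_int k)\<^sup>2 + 1 / (real_of_int k * of_int q)"
      using near k q by (smt (verit) divide_nonneg_nonneg mult_nonneg_nonneg of_int_0_le_iff)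
    also have "1 / (real_of_int k)\<^sup>2 \<le> 4 / (of_int q)\<^sup>2"
    proof -
      have "(real_of_int q)\<^sup>2 \<le> (2 * real_of_int k)\<^sup>2" using pq(2) q by (intro power_mono) auto
      then show ?thesis using k q by (simp add: field_simps)
    qed
    also have "1 / (real_of_int k * of_int q) \<le> 2 / (of_int q)\<^sup>2"
    proof -
      have "real_of_int q * of_int q \<le> (2 * of_int k) * of_int q" using pq(2) q by (intro mult_right_mono) auto
      then show ?thesis using k q by (simp add: field_simps power2_eq_square)
    qed
    finally have "\<bar>X - of_int p / of_nat (nat q)\<bar> \<le> 6 / (real (nat q))\<^sup>2" using q by (simp add: add_divide_distrib)
    moreover have "good_fraction p (nat q)" by (rule good_fraction_neighbour[OF odd pq(3) q])
    ultimately show ?thesis using hk(2) pq q by (intro exI[of _ p] exI[of _ "nat q"]) auto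
  qed
qed

section \<open>Corners and their accumulation at every point of the curve\<close>

text \<open>The factor 25 makes the error bound of \<open>curve_near_good\<close> at most \<open>(H / q)\<^sup>1\<^sup>/\<^sup>2 / 10\<close> as long as
  \<open>H q\<^sup>2 \<le> corner_scale\<close>.\<close>

definition corner_scale :: real where
  "corner_scale = 1 / (25 * inv_square_sum)"

lemma corner_scale_pos: "corner_scale > 0"
  using inv_square_sum_pos by (simp add: corner_scale_def)

text \<open>As the Gauss sum has modulus sqrt q, the leading terms on the two sides of p/q have
  length 2 sqrt (H/q), and their directions differ by the factor i between the square roots of iH
  and -iH.\<close>

lemma corner:
  assumes g: "good_fraction p q" and H: "0 < H" "H * (real q)\<^sup>2 \<le> corner_scale"
  shows "\<exists>\<omega>. norm \<omega> = 1 \<and>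
    norm (curve (of_int p / of_nat q + H) - curve (of_int p / of_nat q) - of_real (2 * sqrt (H / q)) * \<omega>) \<le> sqrt (H / q) / 10 \<and>
    norm (curve (of_int p / of_nat q - H) - curve (of_int p / of_nat q) - of_real (2 * sqrt (H / q)) * (\<i> * \<omega>)) \<le> sqrt (H / q) / 10"
proof -
  define G where "G = gauss_sum q (quad_phase (of_int p / of_nat q)) 0"
  have q: "q > 0" using g by (simp add: good_fraction_def)
  have nG: "norm G = sqrt q"
    unfolding G_def using g by (intro norm_gauss_sum_quad_phase) (auto simp: good_fraction_def)
  define \<omega> where "\<omega> = G / of_real (sqrt q) * cis (- pi / 4)"
  have "norm \<omega> = 1" using q nG by (simp add: \<omega>_def norm_mult norm_divide)
  have err: "5/2 * inv_square_sum * (real q * sqrt q) * (H * sqrt H) \<le> sqrt (H / q) / 10"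
  proof -
    have "5/2 * inv_square_sum * (real q * sqrt q) * (H * sqrt H) = 5/2 * inv_square_sum * (H * (real q)\<^sup>2) * sqrt (H / q)"
    proof -
      have "sqrt q * sqrt q = q" by simp
      then have "real q * sqrt q * sqrt H = (real q)\<^sup>2 * sqrt (H / q)"
        using q by (simp add: real_sqrt_divide power2_eq_square field_simps)
      then show ?thesis by (simp add: mult_ac)
    qed
    also have "\<dots> \<le> 5/2 * inv_square_sum * corner_scale * sqrt (H / q)"
      using H inv_square_sum_pos by (intro mult_right_mono mult_left_mono) auto
    also have "\<dots> = sqrt (H / q) / 10" using inv_square_sum_pos by (simp add: corner_scale_def)
    finally show ?thesis .
  qed
  have main: "2 * G / of_nat q * (of_real (sqrt H) * cis (- pi / 4)) = of_real (2 * sqrt (H / q)) * \<omega>"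
  proof -
    have "complex_of_nat q = of_real (sqrt q) * of_real (sqrt q)" by (simp flip: of_real_mult)
    then show ?thesis using q by (simp add: \<omega>_def real_sqrt_divide)
  qed
  have "cis (pi / 4) = \<i> * cis (- pi / 4)"
    by (simp add: complex_eq_iff cos_45 sin_45)
  then have "2 * G / of_nat q * (of_real (sqrt H) * cis (pi / 4)) = \<i> * (2 * G / of_nat q * (of_real (sqrt H) * cis (- pi / 4)))"
    by simp
  then have main2: "2 * G / of_nat q * (of_real (sqrt H) * cis (pi / 4)) = of_real (2 * sqrt (H / q)) * (\<i> * \<omega>)"
    unfolding main by simp
  have "norm (curve (of_int p / of_nat q + H) - curve (of_int p / of_nat q) - of_real (2 * sqrt (H / q)) * \<omega>) \<le> sqrt (H / q) / 10"
    unfolding main[symmetric] csqrt_imaginary(1)[OF H(1), symmetric] G_def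
    by (rule order_trans[OF curve_near_good[OF g]]) (use H err in simp_all)
  moreover have "norm (curve (of_int p / of_nat q - H) - curve (of_int p / of_nat q) - of_real (2 * sqrt (H / q)) * (\<i> * \<omega>)) \<le> sqrt (H / q) / 10"
  proof -
    have "- H \<noteq> 0" using H by simp
    from order_trans[OF curve_near_good[OF g this], of "sqrt (H / q) / 10"] err H
    show ?thesis unfolding main2[symmetric] csqrt_imaginary(2)[OF H(1), symmetric] G_def by simp
  qed
  ultimately show ?thesis using \<open>norm \<omega> = 1\<close> by blast
qed

text \<open>Corners of arbitrarily small size L = sqrt (H/q) with vertex within C L of the point at
  X. The ratio of distance to size stays bounded, so the corners remain visible at every scale of
  flatness.\<close>

definition corners_near :: "real \<Rightarrow> real \<Rightarrow> bool" where
  "corners_near X C \<longleftrightarrow> (\<forall>\<eta>>0. \<exists>p q H. good_fraction p q \<and> 0 < H \<and> H * (real q)\<^sup>2 \<le> corner_scale \<and>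
     sqrt (H / q) < \<eta> \<and> norm (curve X - curve (of_int p / of_nat q)) \<le> C * sqrt (H / q))"

text \<open>The largest admissible H is \<open>corner_scale / q\<^sup>2\<close>; its corner has size
  sqrt \<open>corner_scale\<close> times q^(-3/2), the order of the assumed distance.\<close>

lemma corners_nearI:
  assumes "\<And>M. \<exists>p q. good_fraction p q \<and> M < q \<and> norm (curve X - curve (of_int p / of_nat q)) \<le> C / (real q * sqrt q)"
  shows "corners_near X (C / sqrt corner_scale)"
  unfolding corners_near_def
proof (intro allI impI)
  fix \<eta> :: real assume \<eta>: "\<eta> > 0"
  obtain M :: nat where M: "M > sqrt corner_scale / \<eta>" using reals_Archimedean2 by blast
  obtain p q where pq: "good_fraction p q" "M < q" "norm (curve X - curve (of_int p / of_nat q)) \<le> C / (real q * sqrt q)"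
    using assms by blast
  have q: "q > 0" "1 \<le> sqrt q" using pq(2) by auto
  define H where "H = corner_scale / (real q)\<^sup>2"
  have L: "sqrt (H / q) = sqrt corner_scale / (real q * sqrt q)"
    unfolding H_def using q by (simp add: real_sqrt_divide real_sqrt_mult)
  have "sqrt (H / q) \<le> sqrt corner_scale / real q"
    unfolding L using q corner_scale_pos by (intro divide_left_mono) auto
  also have "\<dots> < \<eta>"
  proof -
    have "sqrt corner_scale / \<eta> < real q" using M pq(2) by linarith
    then show ?thesis using \<eta> q by (simp add: field_simps)
  qed
  finally have "sqrt (H / q) < \<eta>" .
  moreover have "norm (curve X - curve (of_int p / of_nat q)) \<le> C / sqrt corner_scale * sqrt (H / q)"
    using pq(3) corner_scale_pos unfolding L by simp
  moreover have "0 < H" "H * (real q)\<^sup>2 \<le> corner_scale" using corner_scale_pos q by (auto simp: H_def)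
  ultimately show "\<exists>p q H. good_fraction p q \<and> 0 < H \<and> H * (real q)\<^sup>2 \<le> corner_scale \<and>
     sqrt (H / q) < \<eta> \<and> norm (curve X - curve (of_int p / of_nat q)) \<le> C / sqrt corner_scale * sqrt (H / q)"
    using pq(1) by blast
qed

text \<open>At offset D = O(q^(-2)) from p/q both the leading term q^(-1/2) |D|^(1/2) and the error
  q^(3/2) |D|^(3/2) are O(q^(-3/2)); C adds the two constants. Irrationality ensures that D is
  nonzero.\<close>

lemma corners_near_irrational:
  assumes X: "X \<notin> \<rat>"
  shows "\<exists>C. corners_near X C"
proof -
  define C where "C = 2 * sqrt 6 + 5/2 * inv_square_sum * (6 * sqrt 6)"
  have "\<exists>p q. good_fraction p q \<and> M < q \<and> norm (curve X - curve (of_int p / of_nat q)) \<le> C / (real q * sqrt q)" for M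
  proof -
    obtain p q where pq: "good_fraction p q" "M < q" "\<bar>X - of_int p / of_nat q\<bar> \<le> 6 / (real q)\<^sup>2"
      using good_approximations[OF X] by blast
    have q: "q > 0" using pq(2) by simp
    define D where "D = X - of_int p / of_nat q"
    have D0: "D \<noteq> 0"
    proof
      assume "D = 0"
      then have "X = of_int p / of_int (int q)" by (simp add: D_def)
      then show False using X by (metis Rats_divide Rats_of_int)
    qed
    define G where "G = gauss_sum q (quad_phase (of_int p / of_nat q)) 0"
    have nG: "norm G = sqrt q"
      unfolding G_def using pq(1) by (intro norm_gauss_sum_quad_phase) (auto simp: good_fraction_def)
    have D: "\<bar>D\<bar> \<le> 6 / (real q)\<^sup>2" using pq(3) by (simp add: D_def)
    then have "sqrt \<bar>D\<bar> \<le> sqrt (6 / (real q)\<^sup>2)" by (rule real_sqrt_le_mono)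
    also have "\<dots> = sqrt 6 / q" by (simp add: real_sqrt_divide)
    finally have sD: "sqrt \<bar>D\<bar> \<le> sqrt 6 / q" .
    have qq: "sqrt q * sqrt q = real q" by simp
    have "norm (2 * G / of_nat q * csqrt (- \<i> * of_real D)) = 2 * sqrt q / q * sqrt \<bar>D\<bar>"
      using nG by (simp add: norm_mult norm_divide)
    also have "\<dots> \<le> 2 * sqrt q / q * (sqrt 6 / q)" by (intro mult_left_mono sD) simp
    also have "\<dots> = 2 * sqrt 6 / (real q * sqrt q)" using q qq by (simp add: field_simps)
    finally have 1: "norm (2 * G / of_nat q * csqrt (- \<i> * of_real D)) \<le> 2 * sqrt 6 / (real q * sqrt q)" .
    have "\<bar>D\<bar> * sqrt \<bar>D\<bar> \<le> (6 / (real q)\<^sup>2) * (sqrt 6 / q)" by (intro mult_mono D sD) auto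
    then have "5/2 * inv_square_sum * (real q * sqrt q) * (\<bar>D\<bar> * sqrt \<bar>D\<bar>) \<le>
      5/2 * inv_square_sum * (real q * sqrt q) * ((6 / (real q)\<^sup>2) * (sqrt 6 / q))"
      using inv_square_sum_pos by (intro mult_left_mono) auto
    also have "\<dots> = 5/2 * inv_square_sum * (6 * sqrt 6) / (real q * sqrt q)"
      using q qq by (simp add: field_simps power2_eq_square)
    finally have 2: "5/2 * inv_square_sum * (real q * sqrt q) * (\<bar>D\<bar> * sqrt \<bar>D\<bar>) \<le> 5/2 * inv_square_sum * (6 * sqrt 6) / (real q * sqrt q)" .
    have "norm (curve (of_int p / of_nat q + D) - curve (of_int p / of_nat q) - 2 * G / of_nat q * csqrt (- \<i> * of_real D))
       \<le> 5/2 * inv_square_sum * (real q * sqrt q) * (\<bar>D\<bar> * sqrt \<bar>D\<bar>)"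
      unfolding G_def by (rule curve_near_good[OF pq(1) D0])
    then have "norm (curve (of_int p / of_nat q + D) - curve (of_int p / of_nat q)) \<le>
      2 * sqrt 6 / (real q * sqrt q) + 5/2 * inv_square_sum * (6 * sqrt 6) / (real q * sqrt q)"
      using 1 2 norm_triangle_sub[of "curve (of_int p / of_nat q + D) - curve (of_int p / of_nat q)" "2 * G / of_nat q * csqrt (- \<i> * of_real D)"] by linarith
    then have "norm (curve X - curve (of_int p / of_nat q)) \<le> C / (real q * sqrt q)"
      by (simp add: D_def C_def add_divide_distrib)
    then show ?thesis using pq by blast
  qed
  then show ?thesis using corners_nearI by blast
qed

text \<open>Here the point is itself a vertex, so the fraction stays fixed and only H shrinks; the
  bound q \<open>\<eta>\<^sup>2\<close> / 4 makes the size at most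
  \<open>\<eta> / 2\<close>.\<close>

lemma corners_near_good:
  assumes g: "good_fraction p q"
  shows "corners_near (of_int p / of_nat q) 0"
  unfolding corners_near_def
proof (intro allI impI)
  fix \<eta> :: real assume \<eta>: "\<eta> > 0"
  have q: "q > 0" using g by (simp add: good_fraction_def)
  define H where "H = min (corner_scale / (real q)\<^sup>2) (q * \<eta>\<^sup>2 / 4)"
  have "H > 0" unfolding H_def using q \<eta> corner_scale_pos by simp
  moreover have "H \<le> corner_scale / (real q)\<^sup>2" unfolding H_def by (rule min.cobounded1)
  moreover have "H \<le> q * \<eta>\<^sup>2 / 4" unfolding H_def by (rule min.cobounded2)
  ultimately have H: "H > 0" "H \<le> corner_scale / (real q)\<^sup>2" "H \<le> q * \<eta>\<^sup>2 / 4" .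
  have "H / q \<le> (\<eta> / 2)\<^sup>2" using H(3) q by (simp add: field_simps power2_eq_square)
  then have "sqrt (H / q) \<le> \<eta> / 2" using \<eta> by (intro real_le_lsqrt) auto
  then have "sqrt (H / q) < \<eta>" using \<eta> by simp
  moreover have "H * (real q)\<^sup>2 \<le> corner_scale" using H(2) q by (simp add: field_simps)
  ultimately show "\<exists>p' q' H. good_fraction p' q' \<and> 0 < H \<and> H * (real q')\<^sup>2 \<le> corner_scale \<and>
     sqrt (H / q') < \<eta> \<and> norm (curve (of_int p / of_nat q) - curve (of_int p' / of_nat q')) \<le> 0 * sqrt (H / q')"
    using g H(1) by (intro exI[of _ p] exI[of _ q] exI[of _ H]) auto
qed

text \<open>Neighbours p/q of h/k have offset 1/(kq) <= 1/q. Since the curve moves from h/k only by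
  the 3/2 power of the offset, their vertices are O(q^(-3/2)) away, again the order of their
  corners.\<close>

lemma corners_near_bad:
  assumes k: "k > 0" and cop: "coprime h (int k)" and odd: "odd (h * int k)"
  shows "\<exists>C. corners_near (of_int h / of_nat k) C"
proof -
  let ?X = "real_of_int h / real k"
  define C where "C = 10 * inv_square_sum * (real k)\<^sup>2"
  have C: "C \<ge> 0" using inv_square_sum_pos by (simp add: C_def)
  have "\<exists>p q. good_fraction p q \<and> M < q \<and> norm (curve ?X - curve (of_int p / of_nat q)) \<le> C / (real q * sqrt q)" for M
  proof -
    obtain p q where pq: "int k * int (M + 1) \<le> q" "p * int k - h * q = 1"
      using fraction_neighbour[OF cop, of "int (M + 1)"] k by auto
    have "1 * int (M + 1) \<le> int k * int (M + 1)" using k by (intro mult_right_mono) auto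
    then have "1 * int (M + 1) \<le> q" using pq(1) by (rule order_trans)
    then have q: "q > int M" by simp
    define n where "n = nat q"
    have n: "q = int n" "M < n" using q by (auto simp: n_def)
    then have n0: "n > 0" by simp
    have good: "good_fraction p n" using good_fraction_neighbour[of h "int k" p q] odd pq n by simp
    define D where "D = of_int p / of_nat n - ?X"
    have "real_of_int p * of_nat k - of_int h * of_nat n = 1"
      using pq(2) unfolding n by (metis of_int_1 of_int_diff of_int_mult of_int_of_nat_eq)
    then have "D = 1 / (real k * real n)" unfolding D_def using k n0 by (simp add: field_simps)
    moreover have "1 * real n \<le> real k * real n" using k by (intro mult_right_mono) auto
    ultimately have D: "0 \<le> D" "D \<le> 1 / n" using n0 k by (auto intro!: divide_left_mono)
    have "\<bar>D\<bar> * sqrt \<bar>D\<bar> \<le> 1 / n * sqrt (1 / n)" using D by (intro mult_mono real_sqrt_le_mono) auto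
    also have "\<dots> = 1 / (real n * sqrt n)" by (simp add: real_sqrt_divide)
    finally have DD: "\<bar>D\<bar> * sqrt \<bar>D\<bar> \<le> 1 / (real n * sqrt n)" .
    have "norm (curve (?X + D) - curve ?X) \<le> C * (\<bar>D\<bar> * sqrt \<bar>D\<bar>)"
      unfolding C_def by (rule curve_near_bad[OF k odd])
    also have "\<dots> \<le> C * (1 / (real n * sqrt n))" by (intro mult_left_mono DD C)
    finally have "norm (curve ?X - curve (of_int p / of_nat n)) \<le> C / (real n * sqrt n)"
      by (simp add: D_def norm_minus_commute)
    then show ?thesis using good n(2) by blast
  qed
  then show ?thesis using corners_nearI by blast
qed

lemma corners_near_everywhere: "\<exists>C. corners_near X C"
proof (cases "X \<in> \<rat>")
  case True
  then obtain h k :: int where hk: "k > 0" "coprime h k" "X = of_int h / of_int k"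
    by (metis Rats_cases')
  then have X: "X = of_int h / of_nat (nat k)" and k: "nat k > 0" and cop: "coprime h (int (nat k))" by auto
  show ?thesis
  proof (cases "even (h * int (nat k))")
    case True
    then show ?thesis unfolding X using corners_near_good[of h "nat k"] k cop unfolding good_fraction_def by blast
  next
    case False
    then show ?thesis unfolding X using corners_near_bad[OF k cop] by blast
  qed
qed (rule corners_near_irrational)

section \<open>A right angle does not fit into a thin slab\<close>

theorem theorem1p1:
  fixes t :: real and V :: complex
  assumes "V \<in> sphere 0 1"
  shows "\<not> geometric_tangent (range riemann_phi) (riemann_phi t) V"
proof
  assume tan: "geometric_tangent (range riemann_phi) (riemann_phi t) V"
  have V: "norm V = 1" using assms by simp
  define X where "X = - 4 * pi * t"
  obtain C0 where C0: "corners_near X C0" using corners_near_everywhere by blast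
  \<comment> \<open>The arms of a corner end within 2L + L/10 < 3L of the vertex, itself within (C -
    3) L of the base point; so vertex and both ends lie within C L of it.\<close>
  define C where "C = \<bar>C0\<bar> + 3"
  have C: "C \<ge> 3" "C0 \<le> C - 3" by (auto simp: C_def)
  have conn: "connected (range riemann_phi)"
    by (intro connected_continuous_image continuous_on_riemann_phi connected_UNIV)
  \<comment> \<open>At radius C L, in the scale of \<open>curve\<close>, this tolerance allows a
    deviation of L/20. The factor 4 pi in \<open>\<eta>\<close> below converts between the two
    scales.\<close>
  obtain r0 where r0: "r0 > 0" and flat: "\<And>r P. 0 < r \<Longrightarrow> r < r0 \<Longrightarrow> P \<in> range riemann_phi \<Longrightarrow> dist P (riemann_phi t) < r \<Longrightarrow>
      \<bar>Im (cnj V * (P - riemann_phi t))\<bar> \<le> 1 / (20 * C) * r"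
    using geometric_tangent_imp_flat[OF tan conn _ V, of "1 / (20 * C)"] C by auto
  define \<eta> where "\<eta> = 4 * pi * r0 / C"
  have "\<eta> > 0" using r0 C by (simp add: \<eta>_def)
  then obtain p q H where pqH: "good_fraction p q" "0 < H" "H * (real q)\<^sup>2 \<le> corner_scale"
     "sqrt (H / q) < \<eta>" "norm (curve X - curve (of_int p / of_nat q)) \<le> C0 * sqrt (H / q)"
    using C0 unfolding corners_near_def by blast
  define L where "L = sqrt (H / q)"
  have q: "q > 0" using pqH(1) by (simp add: good_fraction_def)
  have L: "L > 0" unfolding L_def using pqH(2) q by simp
  define Y where "Y = real_of_int p / real q"
  obtain \<omega> where \<omega>: "norm \<omega> = 1"
    "norm (curve (Y + H) - curve Y - of_real (2 * L) * \<omega>) \<le> L / 10"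
    "norm (curve (Y - H) - curve Y - of_real (2 * L) * (\<i> * \<omega>)) \<le> L / 10"
    using corner[OF pqH(1-3)] unfolding L_def Y_def by blast
  have CL: "C0 * L \<le> (C - 3) * L" using C L by (intro mult_right_mono) auto
  have d0: "norm (curve Y - curve X) \<le> (C - 3) * L"
    using pqH(5) CL unfolding L_def[symmetric] Y_def[symmetric] by (simp add: norm_minus_commute)
  have flat_curve: "\<bar>Im (cnj V * (curve Z - curve X))\<bar> \<le> L / 20" if "norm (curve Z - curve X) < C * L" for Z
  proof -
    define P where "P = riemann_phi (- Z / (4 * pi))"
    have "- X / (4 * pi) = t" by (simp add: X_def)
    then have PX: "curve Z - curve X = of_real (4 * pi) * (P - riemann_phi t)"
      unfolding curve_def P_def by (simp add: algebra_simps)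
    define r where "r = C * L / (4 * pi)"
    have "r > 0" using C L by (simp add: r_def)
    moreover have "r < r0" using pqH(4) C unfolding r_def \<eta>_def L_def[symmetric] by (simp add: field_simps)
    moreover have "dist P (riemann_phi t) < r"
    proof -
      have "norm (curve Z - curve X) = 4 * pi * norm (P - riemann_phi t)" unfolding PX norm_mult by simp
      then show ?thesis using that by (simp add: r_def dist_norm field_simps)
    qed
    ultimately have "\<bar>Im (cnj V * (P - riemann_phi t))\<bar> \<le> 1 / (20 * C) * r" by (intro flat) (auto simp: P_def)
    also have "\<dots> = L / (80 * pi)" using C by (simp add: r_def field_simps)
    finally have "4 * pi * \<bar>Im (cnj V * (P - riemann_phi t))\<bar> \<le> L / 20" by (simp add: field_simps)
    moreover have "Im (cnj V * (curve Z - curve X)) = 4 * pi * Im (cnj V * (P - riemann_phi t))"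
      unfolding PX by (simp add: algebra_simps)
    ultimately show ?thesis by (simp add: abs_mult)
  qed
  have small: "\<bar>Im (cnj V * \<zeta>)\<bar> \<le> 1/10" if \<zeta>: "norm \<zeta> = 1" "norm (curve Z - curve Y - of_real (2 * L) * \<zeta>) \<le> L / 10" for Z \<zeta>
  proof -
    have "norm (of_real (2 * L) * \<zeta>) = 2 * L" using L \<zeta>(1) by (simp add: norm_mult)
    then have "norm (curve Z - curve Y) < 3 * L"
      using \<zeta>(2) L norm_triangle_sub[of "curve Z - curve Y" "of_real (2 * L) * \<zeta>"] by linarith
    then have "norm (curve Z - curve X) < 3 * L + (C - 3) * L"
      using d0 norm_triangle_ineq[of "curve Z - curve Y" "curve Y - curve X"] by simp
    also have "\<dots> = C * L" by (simp add: algebra_simps)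
    finally have Z: "\<bar>Im (cnj V * (curve Z - curve X))\<bar> \<le> L / 20" by (rule flat_curve)
    have "(C - 3) * L < C * L" using L by simp
    then have Y: "\<bar>Im (cnj V * (curve Y - curve X))\<bar> \<le> L / 20" using d0 by (intro flat_curve) simp
    have "\<bar>Im (cnj V * (curve Z - curve Y - of_real (2 * L) * \<zeta>))\<bar> \<le> L / 10"
      using \<zeta>(2) V abs_Im_le_cmod[of "cnj V * (curve Z - curve Y - of_real (2 * L) * \<zeta>)"] by (simp add: norm_mult)
    moreover have "cnj V * (curve Z - curve Y - of_real (2 * L) * \<zeta>) =
       cnj V * (curve Z - curve X) - cnj V * (curve Y - curve X) - of_real (2 * L) * (cnj V * \<zeta>)"
      by (simp add: algebra_simps)
    moreover have Im_scale: "Im (of_real (2 * L) * z) = 2 * L * Im z" for z by simp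
    ultimately have "\<bar>Im (cnj V * (curve Z - curve X)) - Im (cnj V * (curve Y - curve X)) - 2 * L * Im (cnj V * \<zeta>)\<bar> \<le> L / 10"
      by (simp only: minus_complex.simps Im_scale)
    \<comment> \<open>Two deviations of L/20 and the corner error L/10 add up to L/5.\<close>
    then have "\<bar>2 * L * Im (cnj V * \<zeta>)\<bar> \<le> L / 5" using Z Y by linarith
    then have "2 * L * \<bar>Im (cnj V * \<zeta>)\<bar> \<le> L / 5" using L by (simp add: abs_mult)
    then show ?thesis using L by (simp add: field_simps)
  qed
  define \<zeta> where "\<zeta> = cnj V * \<omega>"
  have "\<bar>Im \<zeta>\<bar> \<le> 1/10" unfolding \<zeta>_def by (rule small[OF \<omega>(1,2)])
  \<comment> \<open>The perpendicular arm turns the bound on the imaginary part into one on the real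
    part, so the unit vector \<open>\<zeta>\<close> would have norm at most 1/5.\<close>
  moreover have "\<bar>Im (cnj V * (\<i> * \<omega>))\<bar> \<le> 1/10"
    by (rule small[OF _ \<omega>(3)]) (simp add: norm_mult \<omega>(1))
  then have "\<bar>Re \<zeta>\<bar> \<le> 1/10" by (simp add: \<zeta>_def)
  ultimately have "norm \<zeta> \<le> 1/10 + 1/10" using cmod_le[of \<zeta>] by linarith
  moreover have "norm \<zeta> = 1" using V \<omega>(1) by (simp add: \<zeta>_def norm_mult)
  ultimately show False by simp
qed

end
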